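(* Let $H$ be a reduced Krull monoid, $H\hookrightarrow F=\mathcal F(P)$ a cofinal divisor homomorphism, $G=F/H$ its class group, and $G_P\subset G$ the set of all classes containing prime divisors, and suppose $\mathsf D(G_P)\ge2$. For $u\in\mathcal A(H)$ write $U=\boldsymbol\beta(u)$. 1. $H$ is locally tame if and only if $\mathcal B(G_P)$ is locally tame. More precisely, for every $u\in\mathcal A(H)$, $$\mathsf t(G_P,U)\le\mathsf t(H,u)\le\mathsf t(G_P,U)+|U|+1 .$$ 2. For every $u\in\mathcal A(H)$, $$\mathsf t(H,u)\le\max\Big\{\mathsf t(G_P,U),\ \frac{3+(|u|-1)(\mathsf D(G_P)-1)}{2}\Big\}\le1+\frac{|u|(\mathsf D(G_P)-1)}{2}.$$ 3. One has $$\mathsf t(G_P)\le\mathsf t(H)\le\max\Big\{\mathsf t(G_P),\ \frac{3+(\mathsf D(G_P)-1)^2}{2}\Big\}\le1+\frac{\mathsf D(G_P)(\mathsf D(G_P)-1)}{2},$$ and if $\mathsf t(H)>\mathsf D(G_P)$, then $$\mathsf t(H)\le\max\{1+\min\mathsf L(W)\ :\ W\in\mathcal B(G_P\setminus\{0\}),\ |W|\le\mathsf D(G_P)(\mathsf D(G_P)-1)\}.$$ 4. Suppose that $G_P=-G_P$. If $U\in\mathcal A(G_P)$ with $|U|\ge3$, then $\mathsf t(G_P,U)\ge|U|$. In particular, if $\mathsf D(G_P)\ge3$, then $\mathsf t(G_P)\ge\mathsf D(G_P)$.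
   Context: $\mathbb N_0=\{0,1,2,\dots\}$. A monoid is a commutative cancellative semigroup with identity. For a monoid $H$: $H^\times$ is its group of units, $H_{\rm red}=\{aH^\times: a\in H\}$, $H$ is reduced if $H^\times=\{1\}$, $\mathcal A(H)$ is its set of atoms (irreducible elements), $\mathsf q(H)$ its quotient group. $\mathcal F(P)$ is the free abelian monoid with basis $P$; for $a=\prod_{p\in P}p^{\mathsf v_p(a)}\in\mathcal F(P)$ put $|a|=\sum_p\mathsf v_p(a)$. Factorizations and tameness: $\mathsf Z(H)=\mathcal F(\mathcal A(H_{\rm red}))$, $\pi:\mathsf Z(H)\to H_{\rm red}$ is the homomorphism with $\pi(u)=u$ on atoms, $\mathsf Z(a)=\pi^{-1}(aH^\times)$, $\mathsf L(a)=\{|z|:z\in\mathsf Z(a)\}$ for $a\in H$. For $z,z'\in\mathsf Z(H)$, $\mathsf d(z,z')=\max\{|z\gcd(z,z')^{-1}|,|z'\gcd(z,z')^{-1}|\}$. For $a\in H$, $x\in\mathsf Z(H)$, $\mathsf t(a,x)\in\mathbb N_0\cup\{\infty\}$ is the smallest $N$ such that: if $\mathsf Z(a)\cap x\mathsf Z(H)\neq\emptyset$ and $z\in\mathsf Z(a)$, then there is $z'\in\mathsf Z(a)\cap x\mathsf Z(H)$ with $\mathsf d(z,z')\le N$. $\mathsf t(H,u)=\sup_{a\in H}\mathsf t(a,u)$ for $u\in\mathcal A(H_{\rm red})$, $\mathsf t(H)=\sup\{\mathsf t(H,u):u\in\mathcal A(H_{\rm red})\}$. $H$ is locally tame if $\mathsf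 t(H,u)<\infty$ for all $u\in\mathcal A(H_{\rm red})$. Krull monoids: a monoid homomorphism $\varphi:H\to D$ is a divisor homomorphism if $\varphi(a)\mid\varphi(b)$ implies $a\mid b$, and cofinal if every $a\in D$ divides some $\varphi(u)$, $u\in H$. $H$ is a Krull monoid if it has a divisor homomorphism into a free abelian monoid. For a cofinal divisor homomorphism given by an inclusion $H\subset F=\mathcal F(P)$, the class group is $F/H=\mathsf q(F)/\mathsf q(H)$, written additively; $[a]$ is the class of $a$, and $G_P=\{[p]:p\in P\}$ (elements of $P$ are the prime divisors). For $u\in H\subset F$, $|u|$ is the length in $F$. Zero-sum sequences: for an additive abelian group $G$ and $G_0\subset G$, elements of $\mathcal F(G_0)$ are sequences over $G_0$, $\sigma(g_1\cdots g_\ell)=g_1+\dots+g_\ell$, $\mathcal B(G_0)=\{S\in\mathcal F(G_0):\sigma(S)=0\}$, $\mathcal A(G_0)=\mathcal A(\mathcal B(G_0))$, $\mathsf t(G_0)=\mathsf t(\mathcal B(G_0))$, $\mathsf t(G_0,U)=\mathsf t(\mathcal B(G_0),U)$, and $\mathsf D(G_0)=\sup\{|U|:U\in\mathcal A(G_0)\}\in\mathbb N\cup\{\infty\}$ (Davenport constant). The lengths $|S|$ are taken in $\mathcal F(G_0)$. The map $\boldsymbol\beta:H\to\mathcal B(G_P)$ is the restriction to $H$ of the homomorphism $\mathcal F(P)\to\mathcal F(G_P)$ with $p\mapsto[p]$; it maps atoms to atoms. *)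

theory Defs
  imports
    "HOL-Algebra.Divisibility"
    "HOL-Algebra.Free_Abelian_Groups"
    "HOL-Library.Extended_Real"
begin

text \<open>
  A monoid in the sense of factorization theory is a model of \<^locale>\<open>comm_monoid_cancel\<close>.
  The free abelian monoid \<open>\<F>(P)\<close> is the monoid of multisets over \<open>P\<close>; the length
  \<open>|a|\<close> is \<^const>\<open>size\<close>, the valuation \<open>v\<^sub>p(a)\<close> is \<^const>\<open>count\<close>, and the greatest
  common divisor is \<^term>\<open>a \<inter># b\<close>.
\<close>

definition free_abelian_monoid :: "'p set \<Rightarrow> 'p multiset monoid"
  where "free_abelian_monoid P = \<lparr>carrier = {a. set_mset a \<subseteq> P}, monoid.mult = (+), one = {#}\<rparr>"

text \<open>
  The canonical homomorphism from multisets over \<^term>\<open>carrier M\<close> to \<open>M\<close>. It is the map \<open>\<pi>\<close> on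
  factorizations as well as, for an abelian group written multiplicatively, the sum \<open>\<sigma>\<close> of a sequence.
\<close>

definition mset_prod :: "('a, 'm) monoid_scheme \<Rightarrow> 'a multiset \<Rightarrow> 'a"
  where "mset_prod M z = finprod M (\<lambda>x. x [^]\<^bsub>M\<^esub> count z x) (set_mset z)"

definition atoms :: "('a, 'm) monoid_scheme \<Rightarrow> 'a set"
  where "atoms M = {u \<in> carrier M. irreducible M u}"

definition reduced :: "('a, 'm) monoid_scheme \<Rightarrow> bool"
  where "reduced M \<longleftrightarrow> Units M = {\<one>\<^bsub>M\<^esub>}"

definition red_class :: "('a, 'm) monoid_scheme \<Rightarrow> 'a \<Rightarrow> 'a set"
  where "red_class M a = l_coset M a (Units M)"

definition red :: "('a, 'm) monoid_scheme \<Rightarrow> 'a set monoid"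
  where "red M = \<lparr>carrier = red_class M ` carrier M, monoid.mult = set_mult M, one = Units M\<rparr>"


subsection \<open>Factorizations and tameness\<close>

definition factorization_monoid :: "('a, 'm) monoid_scheme \<Rightarrow> 'a set multiset monoid"
  where "factorization_monoid M = free_abelian_monoid (atoms (red M))"

definition factorizations :: "('a, 'm) monoid_scheme \<Rightarrow> 'a \<Rightarrow> 'a set multiset set"
  where "factorizations M a =
    {z \<in> carrier (factorization_monoid M). mset_prod (red M) z = red_class M a}"

definition lengths :: "('a, 'm) monoid_scheme \<Rightarrow> 'a \<Rightarrow> nat set"
  where "lengths M a = size ` factorizations M a"

definition fact_dist :: "'b multiset \<Rightarrow> 'b multiset \<Rightarrow> nat"
  where "fact_dist z z' = max (size (z - z \<inter># z')) (size (z' - z \<inter># z'))"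

definition multiples :: "('a, 'm) monoid_scheme \<Rightarrow> 'a set multiset \<Rightarrow> 'a set multiset set"
  where "multiples M x = {x + y | y. y \<in> carrier (factorization_monoid M)}"

text \<open>\<open>t(a, x)\<close>: the infimum in \<^typ>\<open>enat\<close> is a minimum, or \<open>\<infinity>\<close> if no finite bound exists.\<close>

definition tame_elem :: "('a, 'm) monoid_scheme \<Rightarrow> 'a \<Rightarrow> 'a set multiset \<Rightarrow> enat"
  where "tame_elem M a x = Inf {N :: enat.
    factorizations M a \<inter> multiples M x \<noteq> {} \<longrightarrow>
      (\<forall>z \<in> factorizations M a. \<exists>z' \<in> factorizations M a \<inter> multiples M x.
        enat (fact_dist z z') \<le> N)}"

text \<open>\<open>t(M, u)\<close> for an atom \<open>u\<close> of \<^term>\<open>red M\<close>.\<close>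

definition tame_at :: "('a, 'm) monoid_scheme \<Rightarrow> 'a set \<Rightarrow> enat"
  where "tame_at M u = (SUP a \<in> carrier M. tame_elem M a {#u#})"

definition tame_degree :: "('a, 'm) monoid_scheme \<Rightarrow> enat"
  where "tame_degree M = (SUP u \<in> atoms (red M). tame_at M u)"

definition locally_tame :: "('a, 'm) monoid_scheme \<Rightarrow> bool"
  where "locally_tame M \<longleftrightarrow> (\<forall>u \<in> atoms (red M). tame_at M u < \<infinity>)"


subsection \<open>Divisor homomorphisms and class groups\<close>

definition divisor_hom :: "('a, 'm) monoid_scheme \<Rightarrow> ('b, 'n) monoid_scheme \<Rightarrow> ('a \<Rightarrow> 'b) \<Rightarrow> bool"
  where "divisor_hom H D \<phi> \<longleftrightarrow>
    \<phi> \<in> hom H D \<and> \<phi> \<one>\<^bsub>H\<^esub> = \<one>\<^bsub>D\<^esub> \<and>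
    (\<forall>a \<in> carrier H. \<forall>b \<in> carrier H. \<phi> a divides\<^bsub>D\<^esub> \<phi> b \<longrightarrow> a divides\<^bsub>H\<^esub> b)"

definition cofinal_hom :: "('a, 'm) monoid_scheme \<Rightarrow> ('b, 'n) monoid_scheme \<Rightarrow> ('a \<Rightarrow> 'b) \<Rightarrow> bool"
  where "cofinal_hom H D \<phi> \<longleftrightarrow> (\<forall>a \<in> carrier D. \<exists>u \<in> carrier H. a divides\<^bsub>D\<^esub> \<phi> u)"

text \<open>
  The quotient group of \<open>\<F>(P)\<close> is \<^term>\<open>free_Abelian_group P\<close>, into which \<open>\<F>(P)\<close> embeds via
  \<open>frag_mset\<close>. The quotient group of a submonoid \<open>S \<subseteq> \<F>(P)\<close> is the set of differences.
\<close>

definition frag_mset :: "'p multiset \<Rightarrow> ('p \<Rightarrow>\<^sub>0 int)"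
  where "frag_mset a = (\<Sum>p\<in>#a. frag_of p)"

definition quotient_subgroup :: "'p multiset set \<Rightarrow> ('p \<Rightarrow>\<^sub>0 int) set"
  where "quotient_subgroup S = {frag_mset a - frag_mset b | a b. a \<in> S \<and> b \<in> S}"

text \<open>The class group is written multiplicatively: its zero is the unit of the factor group.\<close>

definition class_group :: "'p set \<Rightarrow> 'p multiset set \<Rightarrow> ('p \<Rightarrow>\<^sub>0 int) set monoid"
  where "class_group P S = free_Abelian_group P Mod quotient_subgroup S"

definition div_class :: "'p set \<Rightarrow> 'p multiset set \<Rightarrow> 'p multiset \<Rightarrow> ('p \<Rightarrow>\<^sub>0 int) set"
  where "div_class P S a = quotient_subgroup S #>\<^bsub>free_Abelian_group P\<^esub> frag_mset a"

definition prime_classes :: "'p set \<Rightarrow> 'p multiset set \<Rightarrow> ('p \<Rightarrow>\<^sub>0 int) set set"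
  where "prime_classes P S = (\<lambda>p. div_class P S {#p#}) ` P"

text \<open>The homomorphism \<open>\<F>(P) \<rightarrow> \<F>(G\<^sub>P)\<close> whose restriction to \<open>S\<close> is \<open>\<beta>\<close>.\<close>

definition block_hom :: "'p set \<Rightarrow> 'p multiset set \<Rightarrow> 'p multiset \<Rightarrow> ('p \<Rightarrow>\<^sub>0 int) set multiset"
  where "block_hom P S a = image_mset (\<lambda>p. div_class P S {#p#}) a"


subsection \<open>Zero-sum sequences\<close>

definition zero_sum_monoid :: "('g, 'm) monoid_scheme \<Rightarrow> 'g set \<Rightarrow> 'g multiset monoid"
  where "zero_sum_monoid G G0 =
    (free_abelian_monoid G0)\<lparr>carrier :=
      {S \<in> carrier (free_abelian_monoid G0). mset_prod G S = \<one>\<^bsub>G\<^esub>}\<rparr>"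

definition davenport :: "('g, 'm) monoid_scheme \<Rightarrow> 'g set \<Rightarrow> enat"
  where "davenport G G0 = (SUP U \<in> atoms (zero_sum_monoid G G0). enat (size U))"

end

theory Submission
  imports Defs
begin

text \<open>
  Since \<open>H\<close> is reduced, the divisor homomorphism embeds it as a saturated submonoid \<open>S\<close> of
  \<open>\<F>(P)\<close>: the elements whose class is trivial, that is, those whose block (the multiset of the
  classes of their prime divisors) is a zero-sum sequence. All four assertions are about multisets
  of prime divisors or classes that are redistributed among a few atoms.

  Two facts link the two sides. Blocks map atoms to atoms, and every factorization of the block of
  \<open>a\<close> lifts to a factorization of \<open>a\<close>, even to one that contains a prescribed atom \<open>u\<close> dividing
  \<open>a\<close> whenever the block \<open>U\<close> of \<open>u\<close> occurs in the factorization of the block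
  (\<open>lift_factorization_with\<close>). Projecting therefore gives \<open>t(G\<^sub>P, U) \<le> t(H, u)\<close>. For the converse,
  one changes a factorization of \<open>a\<close> as in \<open>\<B>(G\<^sub>P)\<close> until it contains an atom \<open>v\<close> with the same block
  as \<open>u\<close>; the prime divisors of \<open>u\<close> lie in at most \<open>|u|\<close> atoms, and exchanging them with those of
  \<open>v\<close> touches at most \<open>|u| + 1\<close> atoms (\<open>tame_bound_lift\<close>).

  The bounds by the Davenport constant \<open>D\<close> start from \<open>cover_atom\<close>: if \<open>u\<close> does not occur in \<open>z\<close>,
  then at most \<open>|u|\<close> atoms of \<open>z\<close> already have a product divisible by \<open>u\<close>, and the quotient \<open>r\<close>
  has no prime divisor of trivial class. All atoms dividing \<open>r\<close> have length at least \<open>2\<close>, so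
  \<open>r\<close> has a factorization of length at most \<open>|r|/2 \<le> |u|(D - 1)/2\<close>. Choosing a factorization of
  minimal length for the block of \<open>r\<close> yields the bound by \<open>1 + min L(W)\<close>. For the sharper bound in
  terms of \<open>t(G\<^sub>P, U)\<close>, let \<open>X\<close> consist of the blocks of the chosen atoms and move in \<open>\<B>(G\<^sub>P)\<close> from \<open>X\<close> to a
  factorization containing \<open>U\<close>, unless \<open>X\<close> already contains \<open>U\<close>. If nothing of \<open>X\<close> survives, the
  distance bounds the new length directly. Otherwise \<open>U\<close> divides a product of fewer than \<open>|u|\<close>
  atoms of \<open>X\<close>, which leaves a shorter quotient to factorize (\<open>tame_bound_lift_max\<close>).

  The lower bound for \<open>G\<^sub>P = -G\<^sub>P\<close> comes from \<open>U(-U)\<close>, which is the product of the \<open>|U|\<close> atoms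
  \<open>g(-g)\<close>, whereas every factorization containing \<open>U\<close> consists of atoms of length at least \<open>3\<close>
  (\<open>tame_bound_symmetric_ge\<close>).
\<close>

section \<open>Distances and covers for multisets\<close>

lemma fact_dist_diff: "fact_dist z z' = max (size (z - z')) (size (z' - z))"
proof -
  have "z - z \<inter># z' = z - z'" "z' - z \<inter># z' = z' - z"
    by (auto simp: multiset_eq_iff)
  then show ?thesis by (simp add: fact_dist_def)
qed

lemma fact_dist_add_left: "fact_dist (y + x) (y + x') = fact_dist x x'"
  by (simp add: fact_dist_diff)

lemma fact_dist_le_sizes: "fact_dist x x' \<le> max (size x) (size x')"
  unfolding fact_dist_diff
  by (meson diff_subset_eq_self max.mono size_mset_mono)

lemma fact_dist_triangle: "fact_dist x z \<le> fact_dist x y + fact_dist y z"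
proof -
  have sub: "a - c \<subseteq># (a - b) + (b - c)" for a b c :: "'a multiset"
    by (auto simp: subseteq_mset_def)
  have "size (x - z) \<le> size (x - y) + size (y - z)" "size (z - x) \<le> size (z - y) + size (y - x)"
    using size_mset_mono[OF sub] by (metis size_union)+
  then show ?thesis
    unfolding fact_dist_diff by linarith
qed

text \<open>
  Splitting off the common part makes the distance a maximum of two sizes, a form that is
  easy to push through maps.
\<close>

lemma obtain_disjoint_parts:
  obtains y x x' where "z = y + x" "z' = y + x'" "x \<inter># x' = {#}"
    "fact_dist z z' = max (size x) (size x')"
proof
  show 1: "z = z \<inter># z' + (z - z')" and 2: "z' = z \<inter># z' + (z' - z)"
    by (auto simp: multiset_eq_iff)
  show "(z - z') \<inter># (z' - z) = {#}"
    by (auto simp: multiset_eq_iff)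
  show "fact_dist z z' = max (size (z - z')) (size (z' - z))"
    by (rule fact_dist_diff)
qed

lemma fact_dist_image_mset_le: "fact_dist (image_mset f z) (image_mset f z') \<le> fact_dist z z'"
proof -
  obtain y x x' where "z = y + x" "z' = y + x'" "fact_dist z z' = max (size x) (size x')"
    by (rule obtain_disjoint_parts)
  then show ?thesis
    using fact_dist_le_sizes[of "image_mset f x" "image_mset f x'"]
    by (simp add: fact_dist_add_left)
qed

lemma fact_dist_image_mset_inj:
  assumes "inj_on f (set_mset z \<union> set_mset z')"
  shows "fact_dist (image_mset f z) (image_mset f z') = fact_dist z z'"
proof -
  obtain y x x' where z: "z = y + x" "z' = y + x'" and dis: "x \<inter># x' = {#}"
    and d: "fact_dist z z' = max (size x) (size x')"
    by (rule obtain_disjoint_parts)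
  have "set_mset x \<inter> set_mset x' = {}"
    using dis by (metis set_mset_empty set_mset_inter)
  then have "f ` set_mset x \<inter> f ` set_mset x' = {}"
    using assms z by (auto simp: inj_on_def)
  then have "image_mset f x \<inter># image_mset f x' = {#}"
    by (metis set_image_mset set_mset_eq_empty_iff set_mset_inter)
  then have "fact_dist (image_mset f x) (image_mset f x') = max (size x) (size x')"
    by (simp add: fact_dist_def)
  then show ?thesis
    using d unfolding z image_mset_union fact_dist_add_left by simp
qed

lemma size_sum_mset_le:
  fixes x :: "'x multiset multiset"
  assumes "\<And>a. a \<in># x \<Longrightarrow> size a \<le> d"
  shows "size (\<Sum>\<^sub># x) \<le> size x * d"
  using assms by (induction x) (auto intro!: add_mono)

lemma size_sum_mset_ge:
  fixes x :: "'x multiset multiset"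
  assumes "\<And>a. a \<in># x \<Longrightarrow> d \<le> size a"
  shows "size x * d \<le> size (\<Sum>\<^sub># x)"
  using assms by (induction x) (auto intro!: add_mono)

lemma image_mset_Sum_mset: "image_mset f (\<Sum>\<^sub># z) = \<Sum>\<^sub># (image_mset (image_mset f) z)"
  by (induction z) auto

lemma mem_subseteq_Sum_mset: "a \<in># z \<Longrightarrow> a \<subseteq># \<Sum>\<^sub># z"
  by (metis insert_DiffM mset_subset_eq_add_left sum_mset.add_mset)

text \<open>
  Cover the elements of \<open>u\<close> one after the other: a member of \<open>z\<close> containing a not yet covered
  element reduces what remains to be covered, so \<open>size u\<close> members suffice.
\<close>

lemma subset_cover:
  assumes "u \<subseteq># \<Sum>\<^sub># z"
  obtains x where "x \<subseteq># z" "u \<subseteq># \<Sum>\<^sub># x" "size x \<le> size u" "\<forall>a\<in>#x. set_mset a \<inter> set_mset u \<noteq> {}"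
proof -
  have "\<exists>x. x \<subseteq># z \<and> u \<subseteq># \<Sum>\<^sub># x \<and> size x \<le> size u \<and> (\<forall>a\<in>#x. set_mset a \<inter> set_mset u \<noteq> {})"
    using assms
  proof (induction "size u" arbitrary: u z rule: less_induct)
    case less
    show ?case
    proof (cases "u = {#}")
      case True
      then show ?thesis by (intro exI[of _ "{#}"]) auto
    next
      case False
      then obtain p where p: "p \<in># u" by auto
      then have "p \<in># \<Sum>\<^sub># z" using less.prems by (meson mset_subset_eqD)
      then obtain a where a: "a \<in># z" "p \<in># a" by auto
      have z: "z = add_mset a (z - {#a#})" using a by simp
      have "u \<subseteq># a + \<Sum>\<^sub># (z - {#a#})"
        using less.prems z by (metis sum_mset.add_mset)
      then have sub: "u - a \<subseteq># \<Sum>\<^sub># (z - {#a#})"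
        by (simp add: subset_eq_diff_conv add.commute)
      have "p \<in># u \<inter># a" using a p by auto
      then have "count (u - a) p < count u p"
        using count_greater_zero_iff[of u p] count_greater_zero_iff[of a p] by simp
      then have "u - a \<noteq> u" by force
      then have "size (u - a) < size u"
        by (simp add: mset_subset_size subset_mset.less_le)
      from less.hyps[OF this sub] obtain x where x: "x \<subseteq># z - {#a#}" "u - a \<subseteq># \<Sum>\<^sub># x"
        "size x \<le> size (u - a)" "\<forall>b\<in>#x. set_mset b \<inter> set_mset (u - a) \<noteq> {}"
        by blast
      show ?thesis
      proof (intro exI[of _ "add_mset a x"] conjI ballI)
        show "add_mset a x \<subseteq># z" using x(1) z by (metis mset_subset_eq_add_mset_cancel)
        show "u \<subseteq># \<Sum>\<^sub># (add_mset a x)"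
          using x(2) by (simp add: subset_eq_diff_conv add.commute)
        show "size (add_mset a x) \<le> size u"
          using x(3) \<open>size (u - a) < size u\<close> by simp
        show "set_mset b \<inter> set_mset u \<noteq> {}" if "b \<in># add_mset a x" for b
          using that x(4) a p by (auto dest: in_diffD)
      qed
    qed
  qed
  then show thesis using that by blast
qed

lemma image_mset_surj:
  assumes "set_mset X \<subseteq> f ` A"
  obtains x where "set_mset x \<subseteq> A" "image_mset f x = X"
proof -
  have "\<exists>x. set_mset x \<subseteq> A \<and> image_mset f x = X"
    using assms
  proof (induction X)
    case (add g X)
    then obtain x p where "set_mset x \<subseteq> A" "image_mset f x = X" "p \<in> A" "g = f p" by auto
    then show ?case by (intro exI[of _ "add_mset p x"]) simp
  qed simp
  then show thesis using that by blast
qed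

section \<open>Saturated sets of multisets and their tame degrees\<close>

text \<open>
  These are the submonoids of a free abelian monoid for which the inclusion is a divisor
  homomorphism: a quotient of two elements lies in \<open>S\<close> as soon as it is a multiset.
\<close>

definition saturated :: "'x multiset set \<Rightarrow> bool"
  where "saturated S \<longleftrightarrow> {#} \<in> S \<and> (\<forall>a\<in>S. \<forall>b. a + b \<in> S \<longleftrightarrow> b \<in> S)"

text \<open>
  The minimal nonempty elements of a saturated set are its atoms, and a factorization is a multiset
  of them.
\<close>

definition min_elems :: "'x multiset set \<Rightarrow> 'x multiset set"
  where "min_elems S = {u \<in> S. u \<noteq> {#} \<and> (\<forall>a\<in>S. a \<subset># u \<longrightarrow> a = {#})}"

text \<open>
  Written with \<open>u \<subseteq># \<Sum>\<^sub># z\<close> in place of an ambient element, this says \<open>t(S, u) \<le> N\<close>.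
\<close>

definition tame_bound :: "'x multiset set \<Rightarrow> 'x multiset \<Rightarrow> nat \<Rightarrow> bool"
  where "tame_bound S u N \<longleftrightarrow>
    (\<forall>z. set_mset z \<subseteq> min_elems S \<longrightarrow> u \<subseteq># \<Sum>\<^sub># z \<longrightarrow>
      (\<exists>z'. set_mset z' \<subseteq> min_elems S \<and> \<Sum>\<^sub># z' = \<Sum>\<^sub># z \<and> u \<in># z' \<and> fact_dist z z' \<le> N))"

lemma tame_boundD:
  assumes "tame_bound S u N" "set_mset z \<subseteq> min_elems S" "u \<subseteq># \<Sum>\<^sub># z"
  obtains z' where "set_mset z' \<subseteq> min_elems S" "\<Sum>\<^sub># z' = \<Sum>\<^sub># z" "u \<in># z'" "fact_dist z z' \<le> N"
  using assms unfolding tame_bound_def by blast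

text \<open>
  It suffices to exchange a part \<open>x\<close> of \<open>z\<close> for some \<open>x'\<close> containing \<open>u\<close>, where both parts have at
  most \<open>N\<close> factors.
\<close>

lemma tame_boundI:
  assumes "\<And>z. set_mset z \<subseteq> min_elems S \<Longrightarrow> u \<subseteq># \<Sum>\<^sub># z \<Longrightarrow> u \<notin># z \<Longrightarrow>
    \<exists>y x x'. z = y + x \<and> set_mset x' \<subseteq> min_elems S \<and> \<Sum>\<^sub># x' = \<Sum>\<^sub># x \<and> u \<in># x'
      \<and> size x \<le> N \<and> size x' \<le> N"
  shows "tame_bound S u N"
  unfolding tame_bound_def
proof (intro allI impI)
  fix z assume z: "set_mset z \<subseteq> min_elems S" "u \<subseteq># \<Sum>\<^sub># z"
  show "\<exists>z'. set_mset z' \<subseteq> min_elems S \<and> \<Sum>\<^sub># z' = \<Sum>\<^sub># z \<and> u \<in># z' \<and> fact_dist z z' \<le> N"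
  proof (cases "u \<in># z")
    case True
    then show ?thesis using z by (intro exI[of _ z]) (simp add: fact_dist_diff)
  next
    case False
    then obtain y x x' where "z = y + x" "set_mset x' \<subseteq> min_elems S" "\<Sum>\<^sub># x' = \<Sum>\<^sub># x" "u \<in># x'"
      "size x \<le> N" "size x' \<le> N" using assms z by blast
    then show ?thesis using z fact_dist_le_sizes[of x x']
      by (intro exI[of _ "y + x'"]) (auto simp: fact_dist_add_left)
  qed
qed

context
  fixes S :: "'x multiset set"
  assumes sat: "saturated S"
begin

lemma saturated_empty: "{#} \<in> S"
  and saturated_cancel: "a \<in> S \<Longrightarrow> a + b \<in> S \<longleftrightarrow> b \<in> S"
  using sat unfolding saturated_def by auto

lemma saturated_Sum: "set_mset z \<subseteq> S \<Longrightarrow> \<Sum>\<^sub># z \<in> S"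
  by (induction z) (auto simp: saturated_empty saturated_cancel)

lemma min_elem_unique: "u \<in> min_elems S \<Longrightarrow> a \<in> S \<Longrightarrow> a \<subseteq># u \<Longrightarrow> a \<noteq> {#} \<Longrightarrow> a = u"
  unfolding min_elems_def by auto

text \<open>
  An element that is not minimal splits into two smaller elements; the size decreases.
\<close>

lemma factorization_exists:
  assumes "a \<in> S"
  obtains z where "set_mset z \<subseteq> min_elems S" "\<Sum>\<^sub># z = a"
proof -
  have "\<exists>z. set_mset z \<subseteq> min_elems S \<and> \<Sum>\<^sub># z = a"
    using assms
  proof (induction "size a" arbitrary: a rule: less_induct)
    case less
    show ?case
    proof (cases "a = {#} \<or> a \<in> min_elems S")
      case True
      then show ?thesis
      proof
        assume "a = {#}" then show ?thesis by (intro exI[of _ "{#}"]) simp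
      next
        assume "a \<in> min_elems S" then show ?thesis by (intro exI[of _ "{#a#}"]) simp
      qed
    next
      case False
      then obtain b where b: "b \<in> S" "b \<subset># a" "b \<noteq> {#}"
        using less.prems unfolding min_elems_def by auto
      then have a: "a = b + (a - b)" by (simp add: subset_mset.less_imp_le)
      have sz: "size b < size a" using b by (simp add: mset_subset_size)
      have "size a = size b + size (a - b)" using a by (metis size_union)
      then have sz': "size (a - b) < size a" using b(3) by (simp add: nonempty_has_size)
      have "a - b \<in> S" using a less.prems b saturated_cancel by metis
      then obtain z z' where z: "set_mset z \<subseteq> min_elems S" "\<Sum>\<^sub># z = b"
         "set_mset z' \<subseteq> min_elems S" "\<Sum>\<^sub># z' = a - b"
        using less.hyps[OF sz b(1)] less.hyps[OF sz'] by auto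
      then show ?thesis using a by (intro exI[of _ "z + z'"]) auto
    qed
  qed
  then show thesis using that by blast
qed

text \<open>
  Without singletons in \<open>S\<close> below \<open>a\<close>, every atom below \<open>a\<close> has size at least two.
\<close>

lemma short_factorization:
  assumes "a \<in> S" "\<forall>p\<in>#a. {#p#} \<notin> S"
  obtains z where "set_mset z \<subseteq> min_elems S" "\<Sum>\<^sub># z = a" "size z * 2 \<le> size a"
proof -
  obtain z where z: "set_mset z \<subseteq> min_elems S" "\<Sum>\<^sub># z = a"
    using factorization_exists assms by blast
  have "2 \<le> size v" if v: "v \<in># z" for v
  proof (rule ccontr)
    assume "\<not> 2 \<le> size v"
    moreover have "v \<noteq> {#}" "v \<in> S" using v z unfolding min_elems_def by auto
    ultimately have "size v = 1"
      using less_2_cases[of "size v"] by auto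
    then obtain p where "v = {#p#}" using size_1_singleton_mset by blast
    moreover have "p \<in># a" using z(2) v \<open>v = {#p#}\<close> by auto
    ultimately show False using assms \<open>v \<in> S\<close> by auto
  qed
  then have "size z * 2 \<le> size a" using size_sum_mset_ge z(2) by blast
  then show thesis using that z by blast
qed

text \<open>
  A prime \<open>p\<close> of \<open>S\<close> (a singleton in \<open>S\<close>) below the chosen atoms would itself be one of them. As
  each chosen atom meets \<open>u\<close>, it would coincide with \<open>u\<close>, which does not occur in \<open>z\<close>.
  This is why the quotient \<open>r\<close> qualifies for \<open>short_factorization\<close>.
\<close>

lemma cover_atom:
  assumes u: "u \<in> min_elems S" and z: "set_mset z \<subseteq> min_elems S" "u \<subseteq># \<Sum>\<^sub># z" "u \<notin># z"
  obtains x r where "x \<subseteq># z" "size x \<le> size u" "\<Sum>\<^sub># x = u + r" "r \<in> S" "\<forall>p\<in>#r. {#p#} \<notin> S"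
proof -
  obtain x where x: "x \<subseteq># z" "u \<subseteq># \<Sum>\<^sub># x" "size x \<le> size u"
     "\<forall>a\<in>#x. set_mset a \<inter> set_mset u \<noteq> {}"
    using subset_cover z(2) by blast
  obtain r where r: "\<Sum>\<^sub># x = u + r" using x(2) by (metis subset_mset.add_diff_inverse)
  have xS: "set_mset x \<subseteq> min_elems S" using x(1) z(1) by (meson set_mset_mono subset_trans)
  have "\<Sum>\<^sub># x \<in> S" using xS saturated_Sum unfolding min_elems_def by blast
  then have rS: "r \<in> S" using r saturated_cancel u unfolding min_elems_def by auto
  have "{#p#} \<notin> S" if p: "p \<in># r" for p
  proof
    assume pS: "{#p#} \<in> S"
    have "p \<in># \<Sum>\<^sub># x" using p r by simp
    then obtain a where a: "a \<in># x" "p \<in># a" by auto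
    then have "a = {#p#}" using min_elem_unique[OF _ pS] xS by auto
    then have "p \<in># u" using x(4) a by auto
    then have "u = {#p#}" using min_elem_unique[OF u pS] by auto
    then show False using z(3) x(1) a \<open>a = {#p#}\<close> by (meson mset_subset_eqD)
  qed
  then show thesis using that x r rS by blast
qed

text \<open>
  An atom of length one is a prime element, so it occurs in every factorization of its
  multiples. With \<open>D = \<infinity>\<close> this settles the one case in which the bounds by \<open>D\<close> stay finite.
\<close>

lemma tame_bound_singleton:
  assumes u: "u \<in> min_elems S" "size u = 1"
  shows "tame_bound S u 0"
proof (rule tame_boundI)
  fix z assume z: "set_mset z \<subseteq> min_elems S" "u \<subseteq># \<Sum>\<^sub># z" "u \<notin># z"
  obtain p where p: "u = {#p#}" using u(2) size_1_singleton_mset by blast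
  then obtain a where a: "a \<in># z" "p \<in># a" using z(2) by auto
  then have "u \<subseteq># a" using p by simp
  then have "u = a" using min_elem_unique[of a u] a z(1) u(1) p unfolding min_elems_def by auto
  then show "\<exists>y x x'. z = y + x \<and> set_mset x' \<subseteq> min_elems S \<and> \<Sum>\<^sub># x' = \<Sum>\<^sub># x \<and> u \<in># x'
      \<and> size x \<le> 0 \<and> size x' \<le> 0" using a z(3) by simp
qed

text \<open>
  The general bound \<open>1 + |u|(D - 1)/2\<close>: the factors covering \<open>u\<close> are replaced by \<open>u\<close> and a short
  factorization of the remaining quotient.
\<close>

lemma tame_bound_half:
  assumes u: "u \<in> min_elems S" and d: "\<And>v. v \<in> min_elems S \<Longrightarrow> size v \<le> d" "2 \<le> d"
  shows "tame_bound S u ((2 + size u * (d - 1)) div 2)"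
proof (rule tame_boundI)
  fix z assume z: "set_mset z \<subseteq> min_elems S" "u \<subseteq># \<Sum>\<^sub># z" "u \<notin># z"
  obtain x r where x: "x \<subseteq># z" "size x \<le> size u" "\<Sum>\<^sub># x = u + r" "r \<in> S" "\<forall>p\<in>#r. {#p#} \<notin> S"
    using cover_atom u z by blast
  obtain y where y: "set_mset y \<subseteq> min_elems S" "\<Sum>\<^sub># y = r" "size y * 2 \<le> size r"
    using short_factorization x by blast
  have "size (\<Sum>\<^sub># x) \<le> size x * d"
    using x(1) z(1) d(1) by (intro size_sum_mset_le) (meson mset_subset_eqD subsetD)
  also have "\<dots> \<le> size u * d" using x(2) by simp
  finally have "size r \<le> size u * (d - 1)" using x(3) by (simp add: diff_mult_distrib2)
  then have ny: "size (add_mset u y) \<le> (2 + size u * (d - 1)) div 2" using y(3) by simp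
  \<comment> \<open>The number of replaced factors obeys the same bound; for \<open>d = 2\<close> because of \<open>size u \<le> d\<close>.\<close>
  have "size u * 2 \<le> 2 + size u * (d - 1)"
  proof (cases "d = 2")
    case True then show ?thesis using d(1)[OF u] by simp
  next
    case False
    then have "size u * 2 \<le> size u * (d - 1)" using d(2) by (intro mult_le_mono2) linarith
    then show ?thesis by linarith
  qed
  then have "size x \<le> (2 + size u * (d - 1)) div 2" using x(2) by simp
  then show "\<exists>y x x'. z = y + x \<and> set_mset x' \<subseteq> min_elems S \<and> \<Sum>\<^sub># x' = \<Sum>\<^sub># x \<and> u \<in># x'
      \<and> size x \<le> (2 + size u * (d - 1)) div 2 \<and> size x' \<le> (2 + size u * (d - 1)) div 2"
    using x y ny u by (intro exI[of _ "z - x"] exI[of _ x] exI[of _ "add_mset u y"]) auto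
qed

text \<open>
  Here \<open>n\<close> is negation. The element \<open>U + n U\<close> has the factorization into the atoms \<open>{#g, n g#}\<close>.
  A factor different from \<open>U\<close> in a factorization containing \<open>U\<close> lies in \<open>n U\<close>, and its negative is
  \<open>U\<close> by minimality; hence all factors have size at least three, and the two factorizations have
  no factor in common.
\<close>

lemma tame_bound_symmetric_ge:
  assumes U: "U \<in> min_elems S" "3 \<le> size U" and t: "tame_bound S U N"
    and n: "\<And>a. a \<in> S \<Longrightarrow> image_mset n a \<in> S" "\<And>g. g \<in># U \<Longrightarrow> n (n g) = g"
       "\<And>g. g \<in># U \<Longrightarrow> {#g, n g#} \<in> S"
  shows "size U \<le> N"
proof -
  have nz: "{#g#} \<notin> S" if "g \<in># U" for g
    using min_elem_unique[OF U(1), of "{#g#}"] that U(2) by force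
  define z where "z = image_mset (\<lambda>g. {#g, n g#}) U"
  have atom: "{#g, n g#} \<in> min_elems S" if g: "g \<in># U" for g
  proof -
    have "a = {#}" if a: "a \<in> S" "a \<subset># {#g, n g#}" for a
    proof (rule ccontr)
      assume "a \<noteq> {#}"
      moreover have "size a < 2" using mset_subset_size[OF a(2)] by simp
      ultimately have "size a = 1"
        using less_2_cases[of "size a"] by auto
      then obtain h where h: "a = {#h#}" using size_1_singleton_mset by blast
      then have "h \<in># {#g, n g#}" using mset_subset_eqD[OF subset_mset.less_imp_le[OF a(2)]] by simp
      then have "h = g \<or> h = n g" by auto
      then have "{#g#} \<in> S"
      proof
        assume "h = n g"
        then have "{#n g#} + {#g#} \<in> S \<longleftrightarrow> {#g#} \<in> S" using a h saturated_cancel by blast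
        then show ?thesis using n(3)[OF g] by (simp add: add_mset_commute)
      qed (use a h in auto)
      then show False using nz g by blast
    qed
    then show ?thesis using n(3)[OF g] unfolding min_elems_def by auto
  qed
  have sum: "\<Sum>\<^sub># (image_mset (\<lambda>g. {#g, n g#}) V) = V + image_mset n V" for V
    by (induction V) auto
  have "set_mset z \<subseteq> min_elems S" "U \<subseteq># \<Sum>\<^sub># z"
    using atom sum unfolding z_def by auto
  then obtain z' where z': "set_mset z' \<subseteq> min_elems S" "\<Sum>\<^sub># z' = \<Sum>\<^sub># z" "U \<in># z'" "fact_dist z z' \<le> N"
    using tame_boundD[OF t] by blast
  obtain y where y: "z' = add_mset U y" using z'(3) by (meson multi_member_split)
  have ysum: "\<Sum>\<^sub># y = image_mset n U" using z'(2) unfolding y z_def sum by simp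
  have big: "3 \<le> size a" if "a \<in># z'" for a
  proof (cases "a = U")
    case False
    then have a: "a \<in># y" using that y by simp
    then have "a \<subseteq># image_mset n U" using ysum mem_subseteq_Sum_mset by metis
    then have "image_mset n a \<subseteq># image_mset n (image_mset n U)" by (rule image_mset_subseteq_mono)
    also have "image_mset n (image_mset n U) = U"
      using n(2) by (simp add: multiset.map_comp o_def cong: image_mset_cong)
    finally have "image_mset n a = U"
      using min_elem_unique[OF U(1) n(1)] z'(1) that unfolding min_elems_def by auto
    then show ?thesis using U(2) by auto
  qed (use U in simp)
  have "z \<inter># z' = {#}"
  proof (rule ccontr)
    assume "z \<inter># z' \<noteq> {#}"
    then obtain a where "a \<in># z \<inter># z'" by auto
    then have "a \<in># z" "a \<in># z'" by auto
    then have "size a = 2" "3 \<le> size a" using big unfolding z_def by auto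
    then show False by simp
  qed
  then have "size z \<le> fact_dist z z'" unfolding fact_dist_def by simp
  then show ?thesis using z'(4) unfolding z_def by simp
qed

end

section \<open>Transfer along a map of the underlying primes\<close>

text \<open>
  The map \<open>c\<close> sends a prime divisor to its class, and \<open>T\<close> stands for the zero-sum sequences. The set \<open>S\<close>
  defined below then is the Krull monoid, and \<open>image_mset c\<close> is the block homomorphism.
\<close>

locale block_transfer =
  fixes P :: "'p set" and c :: "'p \<Rightarrow> 'g" and T :: "'g multiset set"
  assumes sat_T: "saturated T"
    and T_sub: "X \<in> T \<Longrightarrow> set_mset X \<subseteq> c ` P"
begin

definition S :: "'p multiset set"
  where "S = {a. set_mset a \<subseteq> P \<and> image_mset c a \<in> T}"

lemma sat_S: "saturated S"
  using sat_T unfolding saturated_def S_def by auto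

lemma image_S: "a \<in> S \<Longrightarrow> image_mset c a \<in> T"
  unfolding S_def by simp

lemma sub_S: "a + b \<in> S \<Longrightarrow> image_mset c a \<in> T \<Longrightarrow> a \<in> S"
  unfolding S_def by simp

text \<open>
  A proper divisor of \<open>a\<close> has a proper divisor of the block of \<open>a\<close> as its image, and every divisor of
  the block is the image of a divisor of \<open>a\<close>.
\<close>

lemma image_atom_iff: "a \<in> S \<Longrightarrow> image_mset c a \<in> min_elems T \<longleftrightarrow> a \<in> min_elems S"
proof
  assume a: "a \<in> S" and A: "image_mset c a \<in> min_elems T"
  have "b = {#}" if b: "b \<in> S" "b \<subset># a" for b
  proof -
    have "image_mset c b \<subset># image_mset c a"
      using b by (simp add: image_mset_subset_mono)
    then show ?thesis using A image_S[OF b(1)] unfolding min_elems_def by auto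
  qed
  then show "a \<in> min_elems S" using a A unfolding min_elems_def by auto
next
  assume a: "a \<in> S" and A: "a \<in> min_elems S"
  have "X = {#}" if X: "X \<in> T" "X \<subset># image_mset c a" for X
  proof -
    have Xa: "X \<subseteq># image_mset c a" "X \<noteq> image_mset c a" using X(2) by auto
    then obtain Y where Y1: "image_mset c a = X + Y" by (metis subset_mset.add_diff_inverse)
    then have Y: "image_mset c a = X + Y" "Y \<noteq> {#}" using Xa by auto
    obtain x y where xy: "a = x + y" "X = image_mset c x" "Y = image_mset c y"
      using image_mset_eq_plusD[OF Y1] by auto
    have "x \<in> S" using sub_S[of x y] a X(1) xy by simp
    moreover have "x \<subset># a" unfolding subset_mset.less_le using xy Y(2) by auto
    ultimately show ?thesis using A xy unfolding min_elems_def by auto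
  qed
  then show "image_mset c a \<in> min_elems T" using a A image_S unfolding min_elems_def by auto
qed

lemma lift_block:
  assumes "X \<in> T"
  obtains x where "x \<in> S" "image_mset c x = X"
  using image_mset_surj[OF T_sub[OF assms]] assms unfolding S_def by blast

text \<open>
  Distribute the elements of \<open>a\<close> among the factors as prescribed by their images.
\<close>

lemma lift_factorization:
  assumes "a \<in> S" "set_mset Z \<subseteq> min_elems T" "\<Sum>\<^sub># Z = image_mset c a"
  obtains z where "set_mset z \<subseteq> min_elems S" "\<Sum>\<^sub># z = a" "image_mset (image_mset c) z = Z"
proof -
  have "\<exists>z. set_mset z \<subseteq> min_elems S \<and> \<Sum>\<^sub># z = a \<and> image_mset (image_mset c) z = Z"
    using assms
  proof (induction Z arbitrary: a)
    case empty
    then show ?case by (intro exI[of _ "{#}"]) auto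
  next
    case (add X Z)
    then have "image_mset c a = X + \<Sum>\<^sub># Z" by simp
    then obtain x b where xb: "a = x + b" "X = image_mset c x" "\<Sum>\<^sub># Z = image_mset c b"
      using image_mset_eq_plusD by metis
    have X: "X \<in> min_elems T" using add.prems by simp
    then have x: "x \<in> S" using sub_S[of x b] add.prems xb unfolding min_elems_def by auto
    then have "b \<in> S" using add.prems(1) xb(1) saturated_cancel[OF sat_S] by blast
    then obtain z where z: "set_mset z \<subseteq> min_elems S" "\<Sum>\<^sub># z = b" "image_mset (image_mset c) z = Z"
      using add.IH xb add.prems by auto
    then show ?case using x X xb image_atom_iff[OF x] by (intro exI[of _ "add_mset x z"]) auto
  qed
  then show thesis using that by blast
qed

text \<open>
  Lift the factors other than one copy of the image of \<open>u\<close> to a factorization of \<open>a - u\<close>.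
\<close>

lemma lift_factorization_with:
  assumes u: "u \<in> min_elems S" "u \<subseteq># a" and a: "a \<in> S"
    and Z: "set_mset Z \<subseteq> min_elems T" "\<Sum>\<^sub># Z = image_mset c a" "image_mset c u \<in># Z"
  obtains z where "set_mset z \<subseteq> min_elems S" "\<Sum>\<^sub># z = a" "u \<in># z" "image_mset (image_mset c) z = Z"
proof -
  obtain b where b: "a = u + b" using u(2) by (metis subset_mset.add_diff_inverse)
  obtain Y where Y: "Z = add_mset (image_mset c u) Y" using Z(3) by (meson multi_member_split)
  have "b \<in> S" using a u(1) b saturated_cancel[OF sat_S] unfolding min_elems_def by auto
  moreover have "\<Sum>\<^sub># Y = image_mset c b" using Z(2) unfolding b Y by simp
  ultimately obtain y where "set_mset y \<subseteq> min_elems S" "\<Sum>\<^sub># y = b" "image_mset (image_mset c) y = Y"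
    using lift_factorization Z(1) Y by (metis insert_subset set_mset_add_mset_insert)
  then show thesis using that[of "add_mset u y"] u b Y by simp
qed

lemma Sum_min_elems: "set_mset z \<subseteq> min_elems S \<Longrightarrow> \<Sum>\<^sub># z \<in> S"
  using saturated_Sum[OF sat_S] unfolding min_elems_def by blast

lemma image_min_elems: "set_mset z \<subseteq> min_elems S \<Longrightarrow> set_mset (image_mset (image_mset c) z) \<subseteq> min_elems T"
  using image_atom_iff unfolding min_elems_def by auto

text \<open>
  Lift a factorization of a multiple of the block of \<open>u\<close> to one of a multiple of \<open>u\<close>, rearrange
  there, and project; projecting does not increase distances.
\<close>

lemma tame_bound_project:
  assumes u: "u \<in> min_elems S" and t: "tame_bound S u N"
  shows "tame_bound T (image_mset c u) N"
  unfolding tame_bound_def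
proof (intro allI impI)
  fix Z assume Z: "set_mset Z \<subseteq> min_elems T" "image_mset c u \<subseteq># \<Sum>\<^sub># Z"
  have TZ: "\<Sum>\<^sub># Z \<in> T" using saturated_Sum[OF sat_T] Z unfolding min_elems_def by blast
  obtain Y where Y: "\<Sum>\<^sub># Z = image_mset c u + Y" using Z(2) by (metis subset_mset.add_diff_inverse)
  have uS: "u \<in> S" using u unfolding min_elems_def by auto
  have "Y \<in> T" using TZ Y saturated_cancel[OF sat_T image_S[OF uS]] by metis
  then obtain y where y: "y \<in> S" "image_mset c y = Y" using lift_block by blast
  then have "u + y \<in> S" using saturated_cancel[OF sat_S uS] by blast
  then obtain z where z: "set_mset z \<subseteq> min_elems S" "\<Sum>\<^sub># z = u + y" "image_mset (image_mset c) z = Z"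
    using lift_factorization[of "u + y" Z] Z Y y by auto
  then obtain z' where z': "set_mset z' \<subseteq> min_elems S" "\<Sum>\<^sub># z' = \<Sum>\<^sub># z" "u \<in># z'" "fact_dist z z' \<le> N"
    using tame_boundD[OF t z(1)] by (metis mset_subset_eq_add_left)
  let ?Z' = "image_mset (image_mset c) z'"
  have "\<Sum>\<^sub># ?Z' = \<Sum>\<^sub># Z" using z z' by (metis image_mset_Sum_mset)
  moreover have "fact_dist Z ?Z' \<le> N"
    using fact_dist_image_mset_le[of "image_mset c" z z'] z z' by simp
  ultimately show "\<exists>Z'. set_mset Z' \<subseteq> min_elems T \<and> \<Sum>\<^sub># Z' = \<Sum>\<^sub># Z \<and> image_mset c u \<in># Z' \<and> fact_dist Z Z' \<le> N"
    using z' image_min_elems by (intro exI[of _ ?Z']) auto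
qed

text \<open>
  The bound \<open>N\<close> for blocks provides \<open>z1\<close> with a factor \<open>v\<close> whose block is that of \<open>u\<close>. The factors
  of \<open>z1\<close> that cover \<open>u\<close>, together with \<open>v\<close>, can then be refilled with the same blocks such that the
  block of \<open>v\<close> is filled by \<open>u\<close>.
\<close>

lemma tame_bound_lift:
  assumes u: "u \<in> min_elems S" and t: "tame_bound T (image_mset c u) N"
  shows "tame_bound S u (N + size u + 1)"
  unfolding tame_bound_def
proof (intro allI impI)
  fix z assume z: "set_mset z \<subseteq> min_elems S" "u \<subseteq># \<Sum>\<^sub># z"
  let ?U = "image_mset c u" and ?Z = "image_mset (image_mset c) z"
  have "?U \<subseteq># \<Sum>\<^sub># ?Z" using z(2) by (metis image_mset_Sum_mset image_mset_subseteq_mono)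
  then obtain Z' where Z': "set_mset Z' \<subseteq> min_elems T" "\<Sum>\<^sub># Z' = \<Sum>\<^sub># ?Z" "?U \<in># Z'" "fact_dist ?Z Z' \<le> N"
    using tame_boundD[OF t image_min_elems[OF z(1)]] by blast
  obtain Y X X' where YX: "?Z = Y + X" "Z' = Y + X'" and d: "fact_dist ?Z Z' = max (size X) (size X')"
    by (rule obtain_disjoint_parts)
  obtain y x where yx: "z = y + x" "Y = image_mset (image_mset c) y" "X = image_mset (image_mset c) x"
    using image_mset_eq_plusD[OF YX(1)] by auto
  have xS: "set_mset x \<subseteq> min_elems S" "set_mset y \<subseteq> min_elems S" using z(1) yx by auto
  have "\<Sum>\<^sub># X' = \<Sum>\<^sub># X" using Z'(2) YX by simp
  then have "\<Sum>\<^sub># X' = image_mset c (\<Sum>\<^sub># x)" using yx by (simp add: image_mset_Sum_mset)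
  moreover have "set_mset X' \<subseteq> min_elems T" using Z'(1) YX by simp
  ultimately obtain x' where x': "set_mset x' \<subseteq> min_elems S" "\<Sum>\<^sub># x' = \<Sum>\<^sub># x" "image_mset (image_mset c) x' = X'"
    using lift_factorization[OF Sum_min_elems[OF xS(1)]] by blast
  define z1 where "z1 = y + x'"
  have z1: "set_mset z1 \<subseteq> min_elems S" "\<Sum>\<^sub># z1 = \<Sum>\<^sub># z" "image_mset (image_mset c) z1 = Z'"
    using xS x' YX yx unfolding z1_def by auto
  have "size x = size X" "size x' = size X'" using yx x' by auto
  then have "fact_dist x x' \<le> N" using Z'(4) d fact_dist_le_sizes[of x x'] by linarith
  moreover have "fact_dist z z1 = fact_dist x x'"
    by (simp only: z1_def yx(1) fact_dist_add_left)
  ultimately have d1: "fact_dist z z1 \<le> N" by linarith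
  have "?U \<in># image_mset (image_mset c) z1" using Z'(3) unfolding z1(3) .
  then obtain v where v: "v \<in># z1" "image_mset c v = ?U" by auto
  obtain w where w: "w \<subseteq># z1" "u \<subseteq># \<Sum>\<^sub># w" "size w \<le> size u"
    using subset_cover[of u z1] z(2) unfolding z1(2) by blast
  \<comment> \<open>Adding \<open>v\<close> to a cover of \<open>u\<close> makes the block of \<open>u\<close> available among the blocks to be refilled.\<close>
  obtain w1 where w1: "w1 \<subseteq># z1" "u \<subseteq># \<Sum>\<^sub># w1" "size w1 \<le> size u + 1" "v \<in># w1"
  proof (cases "v \<in># w")
    case True
    then show thesis using that[of w] w by simp
  next
    case False
    obtain w0 where w0: "z1 = w + w0" using w(1) by (metis subset_mset.add_diff_inverse)
    then have "v \<in># w0" using False v(1) by simp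
    then have "add_mset v w \<subseteq># z1" unfolding w0
      using subset_mset.add_left_mono[of "{#v#}" w0 w] by simp
    moreover have "u \<subseteq># \<Sum>\<^sub># (add_mset v w)"
      using w(2) by (simp add: subset_mset.add_increasing)
    ultimately show thesis using that[of "add_mset v w"] w by simp
  qed
  obtain y1 where y1: "z1 = y1 + w1" using w1(1) by (metis subset_mset.diff_add)
  have w1S: "set_mset w1 \<subseteq> min_elems S" "set_mset y1 \<subseteq> min_elems S" using z1 y1 by auto
  have "?U \<in># image_mset (image_mset c) w1" using w1(4) unfolding v(2)[symmetric] by simp
  then obtain w' where w': "set_mset w' \<subseteq> min_elems S" "\<Sum>\<^sub># w' = \<Sum>\<^sub># w1" "u \<in># w'"
      "image_mset (image_mset c) w' = image_mset (image_mset c) w1"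
    using lift_factorization_with[OF u w1(2) Sum_min_elems[OF w1S(1)] image_min_elems[OF w1S(1)]
        image_mset_Sum_mset[symmetric]] by blast
  have sum': "\<Sum>\<^sub># (y1 + w') = \<Sum>\<^sub># z" using w'(2) z1(2) unfolding y1 by simp
  have "size w' = size w1" using w'(4) by (metis size_image_mset)
  then have "fact_dist z1 (y1 + w') \<le> size u + 1"
    using fact_dist_le_sizes[of w1 w'] w1(3) unfolding y1 fact_dist_add_left by simp
  then have "fact_dist z (y1 + w') \<le> N + size u + 1"
    using fact_dist_triangle[of z "y1 + w'" z1] d1 by simp
  then show "\<exists>z'. set_mset z' \<subseteq> min_elems S \<and> \<Sum>\<^sub># z' = \<Sum>\<^sub># z \<and> u \<in># z' \<and> fact_dist z z' \<le> N + size u + 1"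
    using w'(1,3) w1S(2) sum' by (intro exI[of _ "y1 + w'"]) auto
qed

lemma size_min_elem_le: "(\<And>V. V \<in> min_elems T \<Longrightarrow> size V \<le> d) \<Longrightarrow> u \<in> min_elems S \<Longrightarrow> size u \<le> d"
  using image_atom_iff[of u] unfolding min_elems_def by (metis (no_types, lifting) mem_Collect_eq size_image_mset)

text \<open>
  Let \<open>X\<close> consist of the blocks of \<open>k \<le> |u|\<close> factors covering \<open>u\<close>. A factorization \<open>X'\<close> of the same
  block that contains the block \<open>U\<close> lifts to one containing \<open>u\<close>, so only the length of \<open>X'\<close> matters.
  If \<open>U\<close> is in \<open>X\<close>, take \<open>X\<close>. If the factorization \<open>X'\<close> supplied by \<open>N\<close> is disjoint from \<open>X\<close>, its
  length is at most \<open>N\<close>. Otherwise the two share \<open>k - j \<ge> 1\<close> factors, so \<open>U\<close> divides the product of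
  the other \<open>j\<close> factors. Their quotient by \<open>U\<close> has size at most \<open>jd - |u|\<close> and thus a
  factorization of at most half that length, which gives at most
  \<open>1 + (jd - |u|)/2 + (k - j) \<le> (3 + (|u| - 1)(d - 1))/2\<close> factors in total.
\<close>

lemma tame_bound_lift_max:
  assumes u: "u \<in> min_elems S" and t: "tame_bound T (image_mset c u) N"
    and d: "\<And>V. V \<in> min_elems T \<Longrightarrow> size V \<le> d" "2 \<le> d"
  shows "tame_bound S u (max N ((3 + (size u - 1) * (d - 1)) div 2))" (is "tame_bound S u (max N ?M)")
proof (rule tame_boundI)
  fix z assume z: "set_mset z \<subseteq> min_elems S" "u \<subseteq># \<Sum>\<^sub># z" "u \<notin># z"
  let ?U = "image_mset c u"
  let ?l = "size u"
  have l: "1 \<le> ?l" "?l \<le> d"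
    using u size_min_elem_le[OF d(1) u] unfolding min_elems_def by (auto simp: Suc_le_eq nonempty_has_size)
  \<comment> \<open>For \<open>d = 2\<close> the inequality relies on \<open>|u| \<le> d\<close>; for larger \<open>d\<close> it holds for every length.\<close>
  have lM: "?l \<le> ?M"
  proof (cases "d = 2")
    case True
    then have "?l = 1 \<or> ?l = 2" using l by linarith
    then show ?thesis using True by auto
  next
    case False
    then have "(?l - 1) * 2 \<le> (?l - 1) * (d - 1)" using d(2) by (intro mult_le_mono2) linarith
    then show ?thesis using l by linarith
  qed
  obtain x r where x: "x \<subseteq># z" "size x \<le> ?l" "\<Sum>\<^sub># x = u + r" "r \<in> S" "\<forall>p\<in>#r. {#p#} \<notin> S"
    using cover_atom[OF sat_S u z] by blast
  have xS: "set_mset x \<subseteq> min_elems S" using x(1) z(1) by (meson set_mset_mono subset_trans)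
  let ?X = "image_mset (image_mset c) x"
  have sumX: "\<Sum>\<^sub># ?X = ?U + image_mset c r" using x(3) by (metis image_mset_Sum_mset image_mset_union)
  have XT: "set_mset ?X \<subseteq> min_elems T" by (rule image_min_elems[OF xS])
  have UT: "?U \<in> min_elems T" using image_atom_iff u unfolding min_elems_def by auto
  have "\<exists>X'. set_mset X' \<subseteq> min_elems T \<and> \<Sum>\<^sub># X' = \<Sum>\<^sub># ?X \<and> ?U \<in># X' \<and> size X' \<le> max N ?M"
  proof (cases "?U \<in># ?X")
    case True
    then show ?thesis using XT x(2) lM by (intro exI[of _ ?X]) auto
  next
    case False
    obtain X' where X': "set_mset X' \<subseteq> min_elems T" "\<Sum>\<^sub># X' = \<Sum>\<^sub># ?X" "?U \<in># X'" "fact_dist ?X X' \<le> N"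
      using tame_boundD[OF t XT] sumX by (metis mset_subset_eq_add_left)
    obtain Y X0 X0' where Y: "?X = Y + X0" "X' = Y + X0'"
      "fact_dist ?X X' = max (size X0) (size X0')"
      by (rule obtain_disjoint_parts)
    show ?thesis
    proof (cases "Y = {#}")
      case True
      then show ?thesis using X' Y by (intro exI[of _ X']) auto
    next
      case Yne: False
      have "?U \<in># X0'" using False X'(3) unfolding Y by auto
      then have "?U \<subseteq># \<Sum>\<^sub># X0'" by (rule mem_subseteq_Sum_mset)
      also have "\<Sum>\<^sub># X0' = \<Sum>\<^sub># X0" using X'(2) unfolding Y by simp
      finally obtain R where R: "\<Sum>\<^sub># X0 = ?U + R" by (metis subset_mset.add_diff_inverse)
      have X0T: "set_mset X0 \<subseteq> min_elems T" "set_mset Y \<subseteq> min_elems T" using XT unfolding Y by auto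
      then have "\<Sum>\<^sub># X0 \<in> T" using saturated_Sum[OF sat_T] unfolding min_elems_def by blast
      then have RT: "R \<in> T" using R saturated_cancel[OF sat_T] UT unfolding min_elems_def by auto
      have "image_mset c r = R + \<Sum>\<^sub># Y" using sumX R unfolding Y by (simp add: add.commute)
      then have "g \<in># image_mset c r" if "g \<in># R" for g using that by simp
      then have "\<forall>g\<in>#R. {#g#} \<notin> T" using x(4,5) unfolding S_def by fastforce
      then obtain V where V: "set_mset V \<subseteq> min_elems T" "\<Sum>\<^sub># V = R" "size V * 2 \<le> size R"
        using short_factorization[OF sat_T RT] by blast
      have "?l + size R = size (\<Sum>\<^sub># X0)" unfolding R by simp
      also have "\<dots> \<le> size X0 * d" using X0T d(1) by (intro size_sum_mset_le) auto
      finally have sR: "?l + size R \<le> size X0 * d" .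
      have "size Y + size X0 \<le> ?l" using x(2) Y(1) by (metis size_image_mset size_union)
      \<comment> \<open>Slack variables make the truncated subtractions harmless: \<open>|u| = (k + 1) + size X0 + m\<close>, \<open>d = e + 2\<close>.\<close>
      then obtain m where m: "size Y + size X0 + m = ?l" using le_Suc_ex by metis
      obtain e where e: "d = e + 2" using d(2) by (metis add.commute le_Suc_ex)
      obtain k where k: "size Y = k + 1"
        using Yne by (metis Suc_eq_plus1 size_eq_0_iff_empty not0_implies_Suc)
      have "size V * 2 + ?l \<le> size X0 * (e + 2)" using sR V(3) unfolding e by linarith
      moreover have "?l = k + 1 + size X0 + m" using m k by simp
      ultimately have "(size V + size Y + 1) * 2 \<le> 3 + (?l - 1) * (e + 1)"
        by (simp add: k algebra_simps)
      then have "size V + size Y + 1 \<le> ?M" by (simp add: e)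
      then show ?thesis using V R UT X0T Y by (intro exI[of _ "add_mset ?U (V + Y)"]) auto
    qed
  qed
  then obtain X' where X': "set_mset X' \<subseteq> min_elems T" "\<Sum>\<^sub># X' = \<Sum>\<^sub># ?X" "?U \<in># X'" "size X' \<le> max N ?M"
    by blast
  have "u \<subseteq># \<Sum>\<^sub># x" using x(3) by simp
  then obtain x' where x': "set_mset x' \<subseteq> min_elems S" "\<Sum>\<^sub># x' = \<Sum>\<^sub># x" "u \<in># x'" "image_mset (image_mset c) x' = X'"
    using lift_factorization_with[OF u _ Sum_min_elems[OF xS] X'(1) _ X'(3)] X'(2)
    by (metis image_mset_Sum_mset)
  have "size x' \<le> max N ?M" using X'(4) x'(4) by auto
  moreover have "size x \<le> max N ?M" using x(2) lM by linarith
  moreover have "z = (z - x) + x" using x(1) by simp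
  ultimately show "\<exists>y x x'. z = y + x \<and> set_mset x' \<subseteq> min_elems S \<and> \<Sum>\<^sub># x' = \<Sum>\<^sub># x \<and> u \<in># x'
      \<and> size x \<le> max N ?M \<and> size x' \<le> max N ?M"
    using x'(1,2,3) by blast
qed

text \<open>
  As for \<open>tame_bound_half\<close>, but the quotient is factorized by lifting the factorization of its block
  that \<open>m\<close> provides. With shortest factorizations this becomes the bound by \<open>1 + min L(W)\<close>.
\<close>

lemma tame_bound_min_lengths:
  assumes u: "u \<in> min_elems S" and d: "\<And>V. V \<in> min_elems T \<Longrightarrow> size V \<le> d"
    and m: "\<And>W. W \<in> T \<Longrightarrow> \<forall>g\<in>#W. {#g#} \<notin> T \<Longrightarrow> size W \<le> d * (d - 1) \<Longrightarrow>
      \<exists>Z. set_mset Z \<subseteq> min_elems T \<and> \<Sum>\<^sub># Z = W \<and> 1 + size Z \<le> m"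
  shows "tame_bound S u (max d m)"
proof (rule tame_boundI)
  fix z assume z: "set_mset z \<subseteq> min_elems S" "u \<subseteq># \<Sum>\<^sub># z" "u \<notin># z"
  have ld: "size u \<le> d" by (rule size_min_elem_le[OF d u])
  obtain x r where x: "x \<subseteq># z" "size x \<le> size u" "\<Sum>\<^sub># x = u + r" "r \<in> S" "\<forall>p\<in>#r. {#p#} \<notin> S"
    using cover_atom[OF sat_S u z] by blast
  have "size a \<le> d" if "a \<in># x" for a
    using size_min_elem_le[OF d] x(1) z(1) that by (meson mset_subset_eqD subsetD)
  then have "size (\<Sum>\<^sub># x) \<le> size x * d" by (rule size_sum_mset_le)
  also have "\<dots> \<le> size u * d" using x(2) by simp
  finally have "size r \<le> size u * (d - 1)" using x(3) by (simp add: diff_mult_distrib2)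
  also have "\<dots> \<le> d * (d - 1)" using ld by simp
  finally have "size (image_mset c r) \<le> d * (d - 1)" by simp
  moreover have "\<forall>g\<in>#image_mset c r. {#g#} \<notin> T" using x(4,5) unfolding S_def by fastforce
  ultimately obtain Z where Z: "set_mset Z \<subseteq> min_elems T" "\<Sum>\<^sub># Z = image_mset c r" "1 + size Z \<le> m"
    using m image_S[OF x(4)] by blast
  obtain y where y: "set_mset y \<subseteq> min_elems S" "\<Sum>\<^sub># y = r" "image_mset (image_mset c) y = Z"
    using lift_factorization[OF x(4) Z(1,2)] by blast
  then have "size y = size Z" by auto
  then show "\<exists>y x x'. z = y + x \<and> set_mset x' \<subseteq> min_elems S \<and> \<Sum>\<^sub># x' = \<Sum>\<^sub># x \<and> u \<in># x'
      \<and> size x \<le> max d m \<and> size x' \<le> max d m"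
    using x y Z ld u by (intro exI[of _ "z - x"] exI[of _ x] exI[of _ "add_mset u y"]) auto
qed

end

section \<open>Reduced monoids realized by multisets\<close>

lemma carrier_free_abelian_monoid [simp]: "carrier (free_abelian_monoid P) = {a. set_mset a \<subseteq> P}"
  and mult_free_abelian_monoid [simp]: "a \<otimes>\<^bsub>free_abelian_monoid P\<^esub> b = a + b"
  and one_free_abelian_monoid [simp]: "\<one>\<^bsub>free_abelian_monoid P\<^esub> = {#}"
  by (simp_all add: free_abelian_monoid_def)

context comm_monoid
begin

lemma mset_prod_empty [simp]: "mset_prod G {#} = \<one>"
  by (simp add: mset_prod_def)

lemma mset_prod_superset:
  assumes "finite A" "set_mset z \<subseteq> A" "A \<subseteq> carrier G"
  shows "mset_prod G z = finprod G (\<lambda>x. x [^] count z x) A"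
  unfolding mset_prod_def
  using assms by (intro finprod_mono_neutral_cong_left) (auto simp: not_in_iff)

lemma mset_prod_closed: "set_mset z \<subseteq> carrier G \<Longrightarrow> mset_prod G z \<in> carrier G"
  unfolding mset_prod_def by (intro finprod_closed) auto

lemma mset_prod_union:
  assumes "set_mset y \<subseteq> carrier G" "set_mset z \<subseteq> carrier G"
  shows "mset_prod G (y + z) = mset_prod G y \<otimes> mset_prod G z"
proof -
  let ?A = "set_mset (y + z)"
  have A: "?A \<subseteq> carrier G" using assms by auto
  have "mset_prod G (y + z) = finprod G (\<lambda>x. x [^] count y x \<otimes> x [^] count z x) ?A"
    unfolding mset_prod_def using A by (intro finprod_cong') (auto simp: nat_pow_mult)
  also have "\<dots> = finprod G (\<lambda>x. x [^] count y x) ?A \<otimes> finprod G (\<lambda>x. x [^] count z x) ?A"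
    using A by (intro finprod_multf) auto
  also have "\<dots> = mset_prod G y \<otimes> mset_prod G z"
    using mset_prod_superset[of ?A y] mset_prod_superset[of ?A z] A by auto
  finally show ?thesis .
qed

lemma mset_prod_single: "x \<in> carrier G \<Longrightarrow> mset_prod G {#x#} = x"
  by (simp add: mset_prod_def)

lemma mset_prod_add_mset:
  "x \<in> carrier G \<Longrightarrow> set_mset z \<subseteq> carrier G \<Longrightarrow> mset_prod G (add_mset x z) = x \<otimes> mset_prod G z"
  using mset_prod_union[of "{#x#}" z] by (simp add: mset_prod_single)

end

text \<open>
  A reduced monoid that is isomorphic to a saturated set of multisets. It is applied to \<open>H\<close>, to the
  monoid of zero-sum sequences, and to \<open>red R\<close> in place of \<open>R\<close>.
\<close>

locale multiset_realization = comm_monoid R for R (structure) +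
  fixes f :: "'a \<Rightarrow> 'x multiset"
  assumes inj: "inj_on f (carrier R)"
    and f_one: "f \<one> = {#}"
    and f_mult: "\<lbrakk>x \<in> carrier R; y \<in> carrier R\<rbrakk> \<Longrightarrow> f (x \<otimes> y) = f x + f y"
    and sat: "saturated (f ` carrier R)"
begin

lemma eq_one_iff: "x \<in> carrier R \<Longrightarrow> f x = {#} \<longleftrightarrow> x = \<one>"
  using inj f_one by (metis inj_onD one_closed)

lemma Units_eq: "Units R = {\<one>}"
proof -
  have "x = \<one>" if "x \<in> Units R" for x
  proof -
    from that obtain y where "x \<in> carrier R" "y \<in> carrier R" "x \<otimes> y = \<one>"
      unfolding Units_def by auto
    then show ?thesis using f_mult[of x y] f_one eq_one_iff by auto
  qed
  then show ?thesis by auto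
qed

text \<open>
  Saturation turns a difference of images into the image of a quotient.
\<close>

lemma divides_iff: "x \<in> carrier R \<Longrightarrow> y \<in> carrier R \<Longrightarrow> x divides y \<longleftrightarrow> f x \<subseteq># f y"
proof
  assume "x \<in> carrier R" "y \<in> carrier R" "x divides y"
  then show "f x \<subseteq># f y" unfolding factor_def by (auto simp: f_mult)
next
  assume x: "x \<in> carrier R" "y \<in> carrier R" and "f x \<subseteq># f y"
  then obtain b where b: "f y = f x + b" by (metis subset_mset.add_diff_inverse)
  have "b \<in> f ` carrier R" using saturated_cancel[OF sat, of "f x" b] x b by (metis imageI)
  then obtain c where c: "c \<in> carrier R" "b = f c" by blast
  then have "f y = f (x \<otimes> c)" using b x f_mult by simp
  then have "y = x \<otimes> c" using inj x c by (meson inj_onD m_closed)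
  then show "x divides y" using c unfolding factor_def by blast
qed

lemma atoms_iff: "x \<in> carrier R \<Longrightarrow> x \<in> atoms R \<longleftrightarrow> f x \<in> min_elems (f ` carrier R)"
  unfolding atoms_def irreducible_def properfactor_def min_elems_def
  by (auto simp: Units_eq eq_one_iff divides_iff subset_mset.less_le_not_le)

lemma image_atoms: "f ` atoms R = min_elems (f ` carrier R)"
proof
  show "f ` atoms R \<subseteq> min_elems (f ` carrier R)" using atoms_iff unfolding atoms_def by auto
  show "min_elems (f ` carrier R) \<subseteq> f ` atoms R" using atoms_iff unfolding min_elems_def by auto
qed

lemma atoms_subset: "atoms R \<subseteq> carrier R"
  unfolding atoms_def by auto

lemma f_mset_prod: "set_mset z \<subseteq> carrier R \<Longrightarrow> f (mset_prod R z) = \<Sum>\<^sub># (image_mset f z)"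
  by (induction z) (auto simp: f_one mset_prod_add_mset f_mult mset_prod_closed)

lemma red_class_eq: "x \<in> carrier R \<Longrightarrow> red_class R x = {x}"
  unfolding red_class_def l_coset_def Units_eq by simp

lemma mult_red: "{x} \<otimes>\<^bsub>red R\<^esub> {y} = {x \<otimes> y}"
  by (simp add: red_def set_mult_def)

lemma one_red: "\<one>\<^bsub>red R\<^esub> = {\<one>}"
  by (simp add: red_def Units_eq)

lemma carrier_red: "carrier (red R) = (\<lambda>x. {x}) ` carrier R"
  by (auto simp: red_def red_class_eq)

text \<open>
  In a monoid realized by multisets the only unit is \<open>\<one>\<close>, so the classes modulo units are
  singletons.
\<close>

lemma realization_red: "multiset_realization (red R) (\<lambda>X. f (the_elem X))"
proof -
  interpret red: comm_monoid "red R"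
    by (unfold_locales) (auto simp: carrier_red mult_red one_red m_ac)
  show ?thesis
  proof unfold_locales
    show "inj_on (\<lambda>X. f (the_elem X)) (carrier (red R))"
      using inj by (auto simp: carrier_red inj_on_def)
    have "(\<lambda>X. f (the_elem X)) ` carrier (red R) = f ` carrier R"
      by (auto simp: carrier_red image_image)
    then show "saturated ((\<lambda>X. f (the_elem X)) ` carrier (red R))" using sat by simp
  qed (auto simp: carrier_red mult_red one_red f_one f_mult)
qed

lemma image_red: "(\<lambda>X. f (the_elem X)) ` carrier (red R) = f ` carrier R"
  by (auto simp: carrier_red image_image)

lemma atoms_red: "atoms (red R) = red_class R ` atoms R"
proof -
  have "X \<in> atoms (red R) \<longleftrightarrow> X \<in> red_class R ` atoms R" if X: "X \<in> carrier (red R)" for X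
  proof -
    obtain x where x: "x \<in> carrier R" "X = {x}" using X carrier_red by auto
    have "X \<in> atoms (red R) \<longleftrightarrow> x \<in> atoms R"
      using multiset_realization.atoms_iff[OF realization_red X] x atoms_iff image_red by simp
    also have "\<dots> \<longleftrightarrow> X \<in> red_class R ` atoms R"
      using x red_class_eq atoms_subset by auto
    finally show ?thesis .
  qed
  moreover have "atoms (red R) \<subseteq> carrier (red R)" unfolding atoms_def by auto
  moreover have "red_class R ` atoms R \<subseteq> carrier (red R)"
    using red_class_eq carrier_red atoms_subset by auto
  ultimately show ?thesis by blast
qed

text \<open>
  The carrier of \<open>red R\<close> consists of singletons, so \<open>the_elem\<close> recovers the
  element on which \<open>f\<close> is evaluated.
\<close>

definition realize :: "'a set multiset \<Rightarrow> 'x multiset multiset"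
  where "realize z = image_mset (\<lambda>X. f (the_elem X)) z"

lemma inj_red: "inj_on (\<lambda>X. f (the_elem X)) (atoms (red R))"
  using multiset_realization.inj[OF realization_red] by (rule inj_on_subset) (auto simp: atoms_def)

lemma realize_atoms: "set_mset z \<subseteq> atoms (red R) \<Longrightarrow> set_mset (realize z) \<subseteq> min_elems (f ` carrier R)"
  using multiset_realization.image_atoms[OF realization_red] image_red unfolding realize_def by auto

lemma realize_surj:
  assumes "set_mset Z \<subseteq> min_elems (f ` carrier R)"
  obtains z where "set_mset z \<subseteq> atoms (red R)" "realize z = Z"
proof -
  have "set_mset Z \<subseteq> (\<lambda>X. f (the_elem X)) ` atoms (red R)"
    using assms multiset_realization.image_atoms[OF realization_red] image_red by simp
  then show thesis using image_mset_surj that unfolding realize_def by blast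
qed

lemma factorizations_iff:
  assumes a: "a \<in> carrier R"
  shows "z \<in> factorizations R a \<longleftrightarrow> set_mset z \<subseteq> atoms (red R) \<and> \<Sum>\<^sub># (realize z) = f a"
proof -
  interpret red: multiset_realization "red R" "\<lambda>X. f (the_elem X)" by (rule realization_red)
  have "mset_prod (red R) z = red_class R a \<longleftrightarrow> \<Sum>\<^sub># (realize z) = f a" if z: "set_mset z \<subseteq> atoms (red R)"
  proof -
    have z': "set_mset z \<subseteq> carrier (red R)" using z by (auto simp: atoms_def)
    have a': "{a} \<in> carrier (red R)" using a carrier_red by auto
    have "mset_prod (red R) z = {a} \<longleftrightarrow> f (the_elem (mset_prod (red R) z)) = f (the_elem {a})"
      using inj_on_eq_iff[OF red.inj red.mset_prod_closed[OF z'] a'] by simp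
    then show ?thesis using red.f_mset_prod[OF z'] a red_class_eq unfolding realize_def by simp
  qed
  then show ?thesis
    unfolding factorizations_def factorization_monoid_def by auto
qed

lemma multiples_iff:
  assumes u: "u \<in> atoms R" and z: "set_mset z \<subseteq> atoms (red R)"
  shows "z \<in> multiples R {#red_class R u#} \<longleftrightarrow> f u \<in># realize z"
proof -
  have U: "red_class R u \<in> atoms (red R)" "f (the_elem (red_class R u)) = f u"
    using u atoms_red red_class_eq atoms_subset by auto
  have "z \<in> multiples R {#red_class R u#} \<longleftrightarrow> red_class R u \<in># z"
  proof
    assume "red_class R u \<in># z"
    then obtain y where "z = {#red_class R u#} + y" by (metis insert_DiffM add_mset_add_single add.commute)
    then show "z \<in> multiples R {#red_class R u#}"
      using z unfolding multiples_def factorization_monoid_def by auto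
  qed (auto simp: multiples_def)
  also have "\<dots> \<longleftrightarrow> f u \<in># realize z"
  proof
    assume "f u \<in># realize z"
    then obtain X where X: "X \<in># z" "f (the_elem X) = f u" unfolding realize_def by auto
    then have "X = red_class R u" using inj_onD[OF inj_red, of X "red_class R u"] U z by auto
    then show "red_class R u \<in># z" using X by simp
  next
    assume "red_class R u \<in># z"
    then show "f u \<in># realize z" using U(2) unfolding realize_def by force
  qed
  finally show ?thesis .
qed

lemma fact_dist_realize:
  "set_mset z \<subseteq> atoms (red R) \<Longrightarrow> set_mset z' \<subseteq> atoms (red R) \<Longrightarrow>
    fact_dist (realize z) (realize z') = fact_dist z z'"
  unfolding realize_def using inj_red by (intro fact_dist_image_mset_inj) (auto intro: inj_on_subset)

lemma lengths_eq:
  assumes "a \<in> carrier R"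
  shows "lengths R a = {size Z | Z. set_mset Z \<subseteq> min_elems (f ` carrier R) \<and> \<Sum>\<^sub># Z = f a}"
proof -
  have sz: "size (realize z) = size z" for z unfolding realize_def by simp
  show ?thesis
  proof (intro Set.set_eqI iffI)
    fix n assume "n \<in> lengths R a"
    then obtain z where "z \<in> factorizations R a" "n = size z" unfolding lengths_def by auto
    then have "set_mset (realize z) \<subseteq> min_elems (f ` carrier R)" "\<Sum>\<^sub># (realize z) = f a" "n = size (realize z)"
      using factorizations_iff[OF assms] realize_atoms sz by auto
    then show "n \<in> {size Z | Z. set_mset Z \<subseteq> min_elems (f ` carrier R) \<and> \<Sum>\<^sub># Z = f a}" by blast
  next
    fix n assume "n \<in> {size Z | Z. set_mset Z \<subseteq> min_elems (f ` carrier R) \<and> \<Sum>\<^sub># Z = f a}"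
    then obtain Z where Z: "set_mset Z \<subseteq> min_elems (f ` carrier R)" "\<Sum>\<^sub># Z = f a" "n = size Z" by blast
    obtain z where "set_mset z \<subseteq> atoms (red R)" "realize z = Z" using realize_surj[OF Z(1)] by blast
    then show "n \<in> lengths R a" using Z factorizations_iff[OF assms] sz unfolding lengths_def by auto
  qed
qed

text \<open>
  The infimum defining the tame degree is attained, as every nonempty set of extended naturals has a
  least element.
\<close>

lemma tame_elem_le_iff:
  "tame_elem R a x \<le> enat N \<longleftrightarrow>
    (factorizations R a \<inter> multiples R x \<noteq> {} \<longrightarrow>
      (\<forall>z \<in> factorizations R a. \<exists>z' \<in> factorizations R a \<inter> multiples R x. fact_dist z z' \<le> N))"
  (is "_ \<longleftrightarrow> ?P (enat N)")
proof -
  let ?Q = "\<lambda>N :: enat. factorizations R a \<inter> multiples R x \<noteq> {} \<longrightarrow>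
      (\<forall>z \<in> factorizations R a. \<exists>z' \<in> factorizations R a \<inter> multiples R x. enat (fact_dist z z') \<le> N)"
  have mono: "?Q M \<Longrightarrow> M \<le> M' \<Longrightarrow> ?Q M'" for M M' by (meson order_trans)
  have "?Q \<infinity>" by auto
  then have "Collect ?Q \<noteq> {}" by blast
  then have "Inf (Collect ?Q) \<in> Collect ?Q"
    unfolding Inf_enat_def by (simp only: if_False) (rule LeastI_ex, blast)
  then have "?Q (Inf (Collect ?Q))" by (simp only: mem_Collect_eq)
  then have "Inf (Collect ?Q) \<le> enat N \<longleftrightarrow> ?Q (enat N)"
    using mono[of "Inf (Collect ?Q)" "enat N"] Inf_lower[of "enat N" "Collect ?Q"] by blast
  then show ?thesis unfolding tame_elem_def by simp
qed

text \<open>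
  The bridge to multisets: a finite bound for the tame degree is a \<open>tame_bound\<close>. The requirement that
  some factorization of \<open>a\<close> contains \<open>u\<close> becomes \<open>u \<subseteq># \<Sum>\<^sub># z\<close>, because quotients in a saturated set
  have factorizations.
\<close>

lemma tame_at_le_iff:
  assumes u: "u \<in> atoms R"
  shows "tame_at R (red_class R u) \<le> enat N \<longleftrightarrow> tame_bound (f ` carrier R) (f u) N"
proof -
  let ?x = "{#red_class R u#}"
  have uS: "f u \<in> f ` carrier R" using u atoms_subset by auto
  have "tame_at R (red_class R u) \<le> enat N \<longleftrightarrow> (\<forall>a\<in>carrier R. tame_elem R a ?x \<le> enat N)"
    unfolding tame_at_def by (rule SUP_le_iff)
  also have "\<dots> \<longleftrightarrow> tame_bound (f ` carrier R) (f u) N"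
  proof
    assume t: "\<forall>a\<in>carrier R. tame_elem R a ?x \<le> enat N"
    show "tame_bound (f ` carrier R) (f u) N"
      unfolding tame_bound_def
    proof (intro allI impI)
      fix Z assume Z: "set_mset Z \<subseteq> min_elems (f ` carrier R)" "f u \<subseteq># \<Sum>\<^sub># Z"
      obtain z where z: "set_mset z \<subseteq> atoms (red R)" "realize z = Z" using realize_surj[OF Z(1)] by blast
      have ZS: "\<Sum>\<^sub># Z \<in> f ` carrier R"
        using saturated_Sum[OF sat, of Z] Z(1) unfolding min_elems_def by blast
      then obtain a where a: "a \<in> carrier R" "\<Sum>\<^sub># Z = f a" by blast
      have za: "z \<in> factorizations R a" using factorizations_iff[OF a(1)] z a by simp
      obtain b where b: "\<Sum>\<^sub># Z = f u + b" using Z(2) by (metis subset_mset.add_diff_inverse)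
      have "b \<in> f ` carrier R" using saturated_cancel[OF sat uS, of b] ZS unfolding b by blast
      then obtain Y where Y: "set_mset Y \<subseteq> min_elems (f ` carrier R)" "\<Sum>\<^sub># Y = b"
        using factorization_exists[OF sat] by blast
      have "set_mset (add_mset (f u) Y) \<subseteq> min_elems (f ` carrier R)"
        using Y(1) u image_atoms by auto
      then obtain y where y: "set_mset y \<subseteq> atoms (red R)" "realize y = add_mset (f u) Y"
        using realize_surj by blast
      have "y \<in> factorizations R a \<inter> multiples R ?x"
        using factorizations_iff[OF a(1)] multiples_iff[OF u y(1)] y Y(2) a(2) b by simp
      then obtain z' where z': "z' \<in> factorizations R a" "z' \<in> multiples R ?x" "fact_dist z z' \<le> N"
        using t a(1) za unfolding tame_elem_le_iff by blast
      then have z'': "set_mset z' \<subseteq> atoms (red R)" "\<Sum>\<^sub># (realize z') = f a"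
        using factorizations_iff[OF a(1)] by auto
      show "\<exists>Z'. set_mset Z' \<subseteq> min_elems (f ` carrier R) \<and> \<Sum>\<^sub># Z' = \<Sum>\<^sub># Z \<and> f u \<in># Z' \<and> fact_dist Z Z' \<le> N"
        using z'' z' multiples_iff[OF u z''(1)] a fact_dist_realize[OF z(1) z''(1)] z(2) realize_atoms
        by (intro exI[of _ "realize z'"]) simp
    qed
  next
    assume t: "tame_bound (f ` carrier R) (f u) N"
    show "\<forall>a\<in>carrier R. tame_elem R a ?x \<le> enat N"
      unfolding tame_elem_le_iff
    proof (intro ballI impI)
      fix a z assume a: "a \<in> carrier R" and ne: "factorizations R a \<inter> multiples R ?x \<noteq> {}"
        and za: "z \<in> factorizations R a"
      obtain y where y: "y \<in> factorizations R a" "y \<in> multiples R ?x" using ne by blast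
      then have "f u \<in># realize y" "\<Sum>\<^sub># (realize y) = f a"
        using factorizations_iff[OF a] multiples_iff[OF u] by auto
      then have "f u \<subseteq># f a" using mem_subseteq_Sum_mset by metis
      moreover have z: "set_mset z \<subseteq> atoms (red R)" "\<Sum>\<^sub># (realize z) = f a"
        using za factorizations_iff[OF a] by auto
      ultimately obtain Z' where Z': "set_mset Z' \<subseteq> min_elems (f ` carrier R)" "\<Sum>\<^sub># Z' = f a"
          "f u \<in># Z'" "fact_dist (realize z) Z' \<le> N"
        using tame_boundD[OF t realize_atoms[OF z(1)]] by auto
      obtain z' where z': "set_mset z' \<subseteq> atoms (red R)" "realize z' = Z'" using realize_surj[OF Z'(1)] by blast
      show "\<exists>z'\<in>factorizations R a \<inter> multiples R ?x. fact_dist z z' \<le> N"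
        using z' Z' factorizations_iff[OF a] multiples_iff[OF u z'(1)] fact_dist_realize[OF z(1) z'(1)]
        by (intro bexI[of _ z']) auto
    qed
  qed
  finally show ?thesis .
qed

end

section \<open>The class group and the monoid of zero-sum sequences\<close>

lemma lookup_frag_mset: "Poly_Mapping.lookup (frag_mset a) p = int (count a p)"
  unfolding frag_mset_def by (induction a) (auto simp: lookup_add)

lemma frag_mset_eq_iff: "frag_mset a = frag_mset b \<longleftrightarrow> a = b"
proof
  assume "frag_mset a = frag_mset b"
  then have "int (count a p) = int (count b p)" for p
    by (simp flip: lookup_frag_mset)
  then show "a = b" by (simp add: multiset_eq_iff)
qed simp

lemma frag_mset_empty [simp]: "frag_mset {#} = 0"
  by (simp add: frag_mset_def)

lemma frag_mset_union [simp]: "frag_mset (a + b) = frag_mset a + frag_mset b"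
  by (simp add: frag_mset_def)

lemma keys_frag_mset [simp]: "Poly_Mapping.keys (frag_mset a) = set_mset a"
  by (auto simp: in_keys_iff lookup_frag_mset)

lemma keys_quotient_subgroup:
  assumes "\<And>a. a \<in> S \<Longrightarrow> set_mset a \<subseteq> P" "x \<in> quotient_subgroup S"
  shows "Poly_Mapping.keys x \<subseteq> P"
  using assms keys_diff unfolding quotient_subgroup_def by fastforce

lemma subgroup_quotient_subgroup:
  assumes sat: "saturated S" and sub: "\<And>a. a \<in> S \<Longrightarrow> set_mset a \<subseteq> P"
  shows "subgroup (quotient_subgroup S) (free_Abelian_group P)"
proof
  show "quotient_subgroup S \<subseteq> carrier (free_Abelian_group P)"
    using keys_quotient_subgroup[OF sub] by auto
  show "\<one>\<^bsub>free_Abelian_group P\<^esub> \<in> quotient_subgroup S"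
    using saturated_empty[OF sat] unfolding quotient_subgroup_def by force
next
  fix x y assume "x \<in> quotient_subgroup S" "y \<in> quotient_subgroup S"
  then obtain a b a' b' where "a \<in> S" "b \<in> S" "a' \<in> S" "b' \<in> S"
    "x = frag_mset a - frag_mset b" "y = frag_mset a' - frag_mset b'"
    unfolding quotient_subgroup_def by blast
  then have "x + y = frag_mset (a + a') - frag_mset (b + b')" "a + a' \<in> S" "b + b' \<in> S"
    using saturated_cancel[OF sat] by auto
  then show "x \<otimes>\<^bsub>free_Abelian_group P\<^esub> y \<in> quotient_subgroup S"
    unfolding quotient_subgroup_def mult_free_Abelian_group by blast
next
  fix x assume x: "x \<in> quotient_subgroup S"
  then obtain a b where "a \<in> S" "b \<in> S" "x = frag_mset a - frag_mset b"
    unfolding quotient_subgroup_def by blast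
  then have "- x \<in> quotient_subgroup S"
    unfolding quotient_subgroup_def by (metis (mono_tags, lifting) mem_Collect_eq minus_diff_eq)
  then show "inv\<^bsub>free_Abelian_group P\<^esub> x \<in> quotient_subgroup S"
    using inv_free_Abelian_group[OF keys_quotient_subgroup[OF sub x]] by simp
qed

text \<open>
  If \<open>a = s - t\<close> in the quotient group, then \<open>t + a = s\<close> in \<open>S\<close>, and saturation applies.
\<close>

lemma frag_mset_in_quotient_subgroup_iff:
  assumes "saturated S"
  shows "frag_mset a \<in> quotient_subgroup S \<longleftrightarrow> a \<in> S"
proof
  assume "frag_mset a \<in> quotient_subgroup S"
  then obtain s t where st: "s \<in> S" "t \<in> S" "frag_mset a = frag_mset s - frag_mset t"
    unfolding quotient_subgroup_def by blast
  then have "frag_mset (t + a) = frag_mset s" by simp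
  then have "t + a = s" unfolding frag_mset_eq_iff .
  then show "a \<in> S" using st saturated_cancel[OF assms] by metis
next
  assume "a \<in> S"
  moreover have "frag_mset a = frag_mset a - frag_mset {#}" by simp
  ultimately show "frag_mset a \<in> quotient_subgroup S"
    unfolding quotient_subgroup_def using saturated_empty[OF assms] by blast
qed

locale saturated_submonoid =
  fixes P :: "'p set" and S :: "'p multiset set"
  assumes sat: "saturated S" and sub: "a \<in> S \<Longrightarrow> set_mset a \<subseteq> P"
begin

abbreviation "F \<equiv> free_Abelian_group P"
abbreviation "N \<equiv> quotient_subgroup S"
abbreviation "Cl \<equiv> class_group P S"
abbreviation "c \<equiv> \<lambda>p. div_class P S {#p#}"

lemma subgroup_N: "subgroup N F"
  by (rule subgroup_quotient_subgroup[OF sat sub])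

lemma comm_group_Cl: "comm_group Cl"
  unfolding class_group_def
  by (rule comm_group.abelian_FactGroup[OF abelian_free_Abelian_group subgroup_N])

sublocale Cl: comm_group Cl
  by (rule comm_group_Cl)

lemma div_class_closed: "set_mset a \<subseteq> P \<Longrightarrow> div_class P S a \<in> carrier Cl"
  unfolding class_group_def div_class_def by (auto simp: carrier_FactGroup)

lemma div_class_union:
  assumes "set_mset a \<subseteq> P" "set_mset b \<subseteq> P"
  shows "div_class P S (a + b) = div_class P S a \<otimes>\<^bsub>Cl\<^esub> div_class P S b"
proof -
  have "N \<lhd> F"
    by (rule comm_group.subgroup_imp_normal[OF abelian_free_Abelian_group subgroup_N])
  then show ?thesis
    using normal.rcos_sum[of N F "frag_mset a" "frag_mset b"] assms
    unfolding class_group_def div_class_def by simp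
qed

lemma div_class_eq_one_iff: "set_mset a \<subseteq> P \<Longrightarrow> div_class P S a = \<one>\<^bsub>Cl\<^esub> \<longleftrightarrow> a \<in> S"
proof -
  assume a: "set_mset a \<subseteq> P"
  then have "div_class P S a = \<one>\<^bsub>Cl\<^esub> \<longleftrightarrow> frag_mset a \<in> N"
    unfolding class_group_def div_class_def one_FactGroup
    using group.coset_join1[OF group_free_Abelian_group _ _ subgroup_N]
      group.coset_join2[OF group_free_Abelian_group _ subgroup_N]
    by auto
  then show ?thesis using frag_mset_in_quotient_subgroup_iff[OF sat] by simp
qed

lemma mset_prod_block:
  "set_mset a \<subseteq> P \<Longrightarrow> mset_prod Cl (image_mset c a) = div_class P S a"
proof (induction a)
  case empty
  then show ?case using div_class_eq_one_iff[of "{#}"] saturated_empty[OF sat] by simp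
next
  case (add p a)
  then have "mset_prod Cl (image_mset c (add_mset p a)) = c p \<otimes>\<^bsub>Cl\<^esub> mset_prod Cl (image_mset c a)"
    using Cl.mset_prod_add_mset[of "c p" "image_mset c a"] div_class_closed[of "{#_#}"] by auto
  then show ?case using add div_class_union[of "{#p#}" a] by simp
qed

abbreviation "GP \<equiv> prime_classes P S"
abbreviation "B \<equiv> zero_sum_monoid Cl GP"

lemma GP_eq: "GP = c ` P"
  by (simp add: prime_classes_def)

lemma GP_carrier: "GP \<subseteq> carrier Cl"
  using div_class_closed unfolding GP_eq by auto

lemma carrier_zero_sum: "carrier (zero_sum_monoid M G0) = {X. set_mset X \<subseteq> G0 \<and> mset_prod M X = \<one>\<^bsub>M\<^esub>}"
  by (simp add: zero_sum_monoid_def)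

lemma mult_zero_sum: "X \<otimes>\<^bsub>zero_sum_monoid M G0\<^esub> Y = X + Y"
  and one_zero_sum: "\<one>\<^bsub>zero_sum_monoid M G0\<^esub> = {#}"
  by (simp_all add: zero_sum_monoid_def free_abelian_monoid_def)

lemma sat_B: "saturated (carrier B)"
proof -
  have "mset_prod Cl (X + Y) = mset_prod Cl Y" if "X \<in> carrier B" "set_mset Y \<subseteq> GP" for X Y
    using that Cl.mset_prod_union[of X Y] GP_carrier Cl.mset_prod_closed[of Y] by (auto simp: carrier_zero_sum)
  then show ?thesis unfolding saturated_def by (auto simp: carrier_zero_sum)
qed

text \<open>
  The product of the classes in the block of \<open>a\<close> is the class of \<open>a\<close>. Hence the block is a zero-sum
  sequence precisely for the elements \<open>a\<close> of \<open>S\<close>.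
\<close>

sublocale block_transfer P c "carrier B"
  rewrites "block_transfer.S P c (carrier B) = S"
proof -
  show tr: "block_transfer P c (carrier B)"
    using sat_B by unfold_locales (auto simp: carrier_zero_sum GP_eq)
  have "image_mset c a \<in> carrier B \<longleftrightarrow> a \<in> S" if "set_mset a \<subseteq> P" for a
    using that mset_prod_block[OF that] div_class_eq_one_iff[OF that]
    by (auto simp: carrier_zero_sum GP_eq simp del: one_FactGroup)
  then show "block_transfer.S P c (carrier B) = S"
    unfolding block_transfer.S_def[OF tr] using sub by blast
qed

sublocale B: multiset_realization B "\<lambda>X. X"
  rewrites "(\<lambda>X. X) ` carrier B = carrier B"
proof -
  show "multiset_realization B (\<lambda>X. X)"
  proof unfold_locales
    show "saturated ((\<lambda>X. X) ` carrier B)" using sat_B by simp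
  qed (use sat_B in \<open>auto simp: mult_zero_sum one_zero_sum saturated_empty saturated_cancel\<close>)
qed simp

lemma atoms_B: "atoms B = min_elems (carrier B)"
  using B.image_atoms by simp

lemma davenport_le_iff: "davenport Cl GP \<le> enat d \<longleftrightarrow> (\<forall>U\<in>min_elems (carrier B). size U \<le> d)"
  unfolding davenport_def atoms_B by (simp add: SUP_le_iff)

text \<open>
  The trivial class is the only one that forms a zero-sum sequence of length one.
\<close>

lemma carrier_zero_free:
  "W \<in> carrier (zero_sum_monoid Cl (GP - {\<one>\<^bsub>Cl\<^esub>})) \<longleftrightarrow> W \<in> carrier B \<and> (\<forall>g\<in>#W. {#g#} \<notin> carrier B)"
  using GP_carrier by (auto simp: carrier_zero_sum Cl.mset_prod_single subset_iff)

lemma mset_prod_inv: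
  "set_mset X \<subseteq> carrier Cl \<Longrightarrow>
    mset_prod Cl (image_mset (\<lambda>g. inv\<^bsub>Cl\<^esub> g) X) = inv\<^bsub>Cl\<^esub> mset_prod Cl X"
proof (induction X)
  case (add g X)
  then have "mset_prod Cl (image_mset (\<lambda>g. inv\<^bsub>Cl\<^esub> g) (add_mset g X))
      = inv\<^bsub>Cl\<^esub> g \<otimes>\<^bsub>Cl\<^esub> mset_prod Cl (image_mset (\<lambda>g. inv\<^bsub>Cl\<^esub> g) X)"
    using Cl.mset_prod_add_mset[of "inv\<^bsub>Cl\<^esub> g" "image_mset (\<lambda>g. inv\<^bsub>Cl\<^esub> g) X"] by auto
  then show ?case using add Cl.inv_mult[of g "mset_prod Cl X"]
    by (simp add: Cl.mset_prod_add_mset Cl.mset_prod_closed)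
qed simp

lemma tame_bound_ge_size:
  assumes sym: "GP = (\<lambda>g. inv\<^bsub>Cl\<^esub> g) ` GP"
    and U: "U \<in> min_elems (carrier B)" "3 \<le> size U" and t: "tame_bound (carrier B) U M"
  shows "size U \<le> M"
proof (rule tame_bound_symmetric_ge[OF sat_B U t])
  let ?n = "\<lambda>g. inv\<^bsub>Cl\<^esub> g"
  have n: "?n g \<in> GP" if "g \<in> GP" for g using sym that by blast
  show "image_mset ?n X \<in> carrier B" if "X \<in> carrier B" for X
    using that n mset_prod_inv[of X] GP_carrier by (auto simp: carrier_zero_sum)
  have U': "set_mset U \<subseteq> GP" using U(1) unfolding min_elems_def by (auto simp: carrier_zero_sum)
  show "?n (?n g) = g" if "g \<in># U" for g using that U' GP_carrier by auto
  show "{#g, ?n g#} \<in> carrier B" if "g \<in># U" for g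
  proof -
    have "g \<in> GP" "g \<in> carrier Cl" using that U' GP_carrier by auto
    then show ?thesis using n by (simp add: carrier_zero_sum Cl.mset_prod_add_mset Cl.mset_prod_single)
  qed
qed

end

text \<open>
  Elements with equal images divide each other, hence are equal in a reduced monoid; the divisor
  property is saturation of the image.
\<close>

lemma realization_of_divisor_hom:
  fixes \<phi> :: "'a \<Rightarrow> 'p multiset"
  assumes H: "comm_monoid_cancel H" "reduced H" and \<phi>: "divisor_hom H (free_abelian_monoid P) \<phi>"
  shows "multiset_realization H \<phi>" "\<And>a. a \<in> \<phi> ` carrier H \<Longrightarrow> set_mset a \<subseteq> P"
proof -
  interpret H: comm_monoid_cancel H by (rule H)
  have car: "set_mset (\<phi> x) \<subseteq> P" if "x \<in> carrier H" for x
    using \<phi> that unfolding divisor_hom_def hom_def by auto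
  have mult: "\<phi> (x \<otimes>\<^bsub>H\<^esub> y) = \<phi> x + \<phi> y" if "x \<in> carrier H" "y \<in> carrier H" for x y
    using \<phi> that unfolding divisor_hom_def hom_def by auto
  have one: "\<phi> \<one>\<^bsub>H\<^esub> = {#}" using \<phi> unfolding divisor_hom_def by simp
  have div: "x divides\<^bsub>H\<^esub> y" if x: "x \<in> carrier H" "y \<in> carrier H" "\<phi> y = \<phi> x + b" for x y b
  proof -
    have "b \<in> carrier (free_abelian_monoid P)" using car[OF x(2)] x(3) by auto
    then have "\<phi> x divides\<^bsub>free_abelian_monoid P\<^esub> \<phi> y" unfolding factor_def using x(3) by auto
    then show ?thesis using \<phi> x unfolding divisor_hom_def by blast
  qed
  show "\<And>a. a \<in> \<phi> ` carrier H \<Longrightarrow> set_mset a \<subseteq> P" using car by auto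
  show "multiset_realization H \<phi>"
  proof unfold_locales
    show "inj_on \<phi> (carrier H)"
    proof (rule inj_onI)
      fix x y assume xy: "x \<in> carrier H" "y \<in> carrier H" "\<phi> x = \<phi> y"
      then obtain c d where c: "c \<in> carrier H" "y = x \<otimes>\<^bsub>H\<^esub> c" and d: "d \<in> carrier H" "x = y \<otimes>\<^bsub>H\<^esub> d"
        using div[of x y "{#}"] div[of y x "{#}"] unfolding factor_def by auto
      have "x \<otimes>\<^bsub>H\<^esub> (c \<otimes>\<^bsub>H\<^esub> d) = x \<otimes>\<^bsub>H\<^esub> \<one>\<^bsub>H\<^esub>"
        using c d xy(1) by (metis H.m_assoc H.r_one)
      then have "c \<otimes>\<^bsub>H\<^esub> d = \<one>\<^bsub>H\<^esub>" using c d xy H.l_cancel by (meson H.m_closed H.one_closed)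
      moreover have "d \<otimes>\<^bsub>H\<^esub> c = c \<otimes>\<^bsub>H\<^esub> d" using d(1) c(1) by (rule H.m_comm)
      ultimately have "c \<in> Units H" unfolding Units_def using c(1) d(1) by auto
      then show "x = y" using H(2) c xy unfolding reduced_def by auto
    qed
    show "saturated (\<phi> ` carrier H)"
      unfolding saturated_def
    proof (intro conjI ballI allI)
      show "{#} \<in> \<phi> ` carrier H" using one H.one_closed by (metis imageI)
      fix a b assume "a \<in> \<phi> ` carrier H"
      then obtain x where x: "x \<in> carrier H" "a = \<phi> x" by blast
      show "a + b \<in> \<phi> ` carrier H \<longleftrightarrow> b \<in> \<phi> ` carrier H"
      proof
        assume "a + b \<in> \<phi> ` carrier H"
        then obtain y where y: "y \<in> carrier H" "\<phi> y = \<phi> x + b" using x by auto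
        then obtain z where "z \<in> carrier H" "y = x \<otimes>\<^bsub>H\<^esub> z" using div[of x y b] x unfolding factor_def by auto
        then show "b \<in> \<phi> ` carrier H" using mult[of x z] x y by auto
      next
        assume "b \<in> \<phi> ` carrier H"
        then obtain y where "y \<in> carrier H" "b = \<phi> y" by blast
        then show "a + b \<in> \<phi> ` carrier H" using mult[of x y] x H.m_closed by (metis imageI)
      qed
    qed
  qed (use one mult in auto)
qed

section \<open>Bounds in the extended reals\<close>

lemma enat_leI: "(\<And>n. y \<le> enat n \<Longrightarrow> x \<le> enat n) \<Longrightarrow> x \<le> (y :: enat)"
  by (cases y) auto

lemma ereal_half_bounds:
  fixes s t :: enat and d l :: nat
  assumes d: "2 \<le> d" and l: "1 \<le> l"
    and st: "s \<le> max t (enat ((3 + (l - 1) * (d - 1)) div 2))" and t: "t \<le> enat ((2 + l * (d - 1)) div 2)"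
  shows "ereal_of_enat s \<le> max (ereal_of_enat t) (ereal ((3 + (real l - 1) * (real d - 1)) / 2))"
    and "max (ereal_of_enat t) (ereal ((3 + (real l - 1) * (real d - 1)) / 2)) \<le> ereal (1 + real l * (real d - 1) / 2)"
proof -
  have half: "real (n div 2) \<le> real n / 2" for n :: nat
  proof -
    have "real (2 * (n div 2)) \<le> real n" unfolding of_nat_le_iff by simp
    then show ?thesis by simp
  qed
  have "real ((3 + (l - 1) * (d - 1)) div 2) \<le> (3 + (real l - 1) * (real d - 1)) / 2"
    using half[of "3 + (l - 1) * (d - 1)"] d l by (simp add: of_nat_diff)
  then have 1: "ereal_of_enat (enat ((3 + (l - 1) * (d - 1)) div 2)) \<le> ereal ((3 + (real l - 1) * (real d - 1)) / 2)"
    by simp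
  have "ereal_of_enat s \<le> max (ereal_of_enat t) (ereal_of_enat (enat ((3 + (l - 1) * (d - 1)) div 2)))"
    using st by (metis (no_types, lifting) ereal_of_enat_le_iff max_def)
  also have "\<dots> \<le> max (ereal_of_enat t) (ereal ((3 + (real l - 1) * (real d - 1)) / 2))"
    using 1 by (rule max.mono[OF order_refl])
  finally show "ereal_of_enat s \<le> max (ereal_of_enat t) (ereal ((3 + (real l - 1) * (real d - 1)) / 2))" .
  have "real ((2 + l * (d - 1)) div 2) \<le> 1 + real l * (real d - 1) / 2"
    using half[of "2 + l * (d - 1)"] d by (simp add: of_nat_diff field_simps)
  then have "ereal_of_enat (enat ((2 + l * (d - 1)) div 2)) \<le> ereal (1 + real l * (real d - 1) / 2)"
    by simp
  then have 2: "ereal_of_enat t \<le> ereal (1 + real l * (real d - 1) / 2)"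
    using t ereal_of_enat_le_iff order_trans by metis
  have "(3 + (real l - 1) * (real d - 1)) / 2 \<le> 1 + real l * (real d - 1) / 2"
    using d by (simp add: field_simps)
  then show "max (ereal_of_enat t) (ereal ((3 + (real l - 1) * (real d - 1)) / 2)) \<le> ereal (1 + real l * (real d - 1) / 2)"
    using 2 by simp
qed

text \<open>
  For \<open>D = \<infinity>\<close> and \<open>l = 1\<close> the product with \<open>l - 1\<close> is \<open>0 * \<infinity> = 0\<close> in the extended
  reals, so the upper bound stays finite; in this case both tame degrees vanish.
\<close>

lemma ereal_local_bounds:
  fixes s t D :: enat and l :: nat
  assumes D: "2 \<le> D" and l: "1 \<le> l" and one: "l = 1 \<Longrightarrow> s = 0 \<and> t = 0"
    and fin: "\<And>d. D = enat d \<Longrightarrow> s \<le> max t (enat ((3 + (l - 1) * (d - 1)) div 2)) \<and>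
      t \<le> enat ((2 + l * (d - 1)) div 2)"
  shows "ereal_of_enat s \<le> max (ereal_of_enat t) ((3 + (ereal (real l) - 1) * (ereal_of_enat D - 1)) / 2) \<and>
    max (ereal_of_enat t) ((3 + (ereal (real l) - 1) * (ereal_of_enat D - 1)) / 2)
      \<le> 1 + ereal (real l) * (ereal_of_enat D - 1) / 2"
proof (cases D)
  case (enat d)
  have d: "2 \<le> d" using D enat by (simp add: numeral_eq_enat)
  have eq: "(3 + (ereal (real l) - 1) * (ereal_of_enat D - 1)) / 2 = ereal ((3 + (real l - 1) * (real d - 1)) / 2)"
    "1 + ereal (real l) * (ereal_of_enat D - 1) / 2 = ereal (1 + real l * (real d - 1) / 2)"
    using enat by (simp_all add: one_ereal_def numeral_eq_ereal)
  show ?thesis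
    unfolding eq using ereal_half_bounds[OF d l] fin[OF enat] by blast
next
  case infinity
  show ?thesis
  proof (cases "l = 1")
    case True
    then show ?thesis using one infinity by (simp add: one_ereal_def numeral_eq_ereal)
  next
    case False
    then have "real l - 1 > 0" using l by simp
    then have 1: "(ereal (real l) - 1) * (ereal_of_enat D - 1) = \<infinity>"
      using infinity by (simp add: one_ereal_def)
    have 2: "ereal (real l) * (ereal_of_enat D - 1) = \<infinity>"
      using infinity l by (simp add: one_ereal_def)
    show ?thesis unfolding 1 2 by simp
  qed
qed

lemma ereal_global_bounds:
  fixes s t D :: enat
  assumes D: "2 \<le> D"
    and fin: "\<And>d. D = enat d \<Longrightarrow> s \<le> max t (enat ((3 + (d - 1) * (d - 1)) div 2)) \<and>
      t \<le> enat ((2 + d * (d - 1)) div 2)"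
  shows "ereal_of_enat s \<le> max (ereal_of_enat t) ((3 + (ereal_of_enat D - 1)\<^sup>2) / 2) \<and>
    max (ereal_of_enat t) ((3 + (ereal_of_enat D - 1)\<^sup>2) / 2)
      \<le> 1 + ereal_of_enat D * (ereal_of_enat D - 1) / 2"
proof (cases D)
  case (enat d)
  have d: "2 \<le> d" "1 \<le> d" using D enat by (simp_all add: numeral_eq_enat)
  have eq: "(3 + (ereal_of_enat D - 1)\<^sup>2) / 2 = ereal ((3 + (real d - 1) * (real d - 1)) / 2)"
    "1 + ereal_of_enat D * (ereal_of_enat D - 1) / 2 = ereal (1 + real d * (real d - 1) / 2)"
    using enat by (simp_all add: one_ereal_def numeral_eq_ereal power2_eq_square)
  show ?thesis
    unfolding eq using ereal_half_bounds[OF d] fin[OF enat] by blast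
next
  case infinity
  then show ?thesis by (simp add: one_ereal_def power2_eq_square)
qed

section \<open>Local and global tameness of Krull monoids\<close>

theorem proposition3p3:
  fixes H :: "'a monoid"
    and P :: "'p set"
    and \<phi> :: "'a \<Rightarrow> 'p multiset"
    and G :: "('p \<Rightarrow>\<^sub>0 int) set monoid"
    and GP :: "('p \<Rightarrow>\<^sub>0 int) set set"
    and B :: "('p \<Rightarrow>\<^sub>0 int) set multiset monoid"
    and D :: enat
    and \<beta> :: "'a \<Rightarrow> ('p \<Rightarrow>\<^sub>0 int) set multiset"
  assumes H: "comm_monoid_cancel H" "reduced H"
    and \<phi>: "divisor_hom H (free_abelian_monoid P) \<phi>" "cofinal_hom H (free_abelian_monoid P) \<phi>"
    and G: "G = class_group P (\<phi> ` carrier H)"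
    and GP: "GP = prime_classes P (\<phi> ` carrier H)"
    and \<beta>: "\<beta> = (\<lambda>u. block_hom P (\<phi> ` carrier H) (\<phi> u))"
    and B: "B = zero_sum_monoid G GP"
    and D: "D = davenport G GP"
    and D_ge_2: "D \<ge> 2"
  shows
    "((locally_tame H \<longleftrightarrow> locally_tame B) \<and>
      (\<forall>u \<in> atoms H.
         tame_at B (red_class B (\<beta> u)) \<le> tame_at H (red_class H u) \<and>
         tame_at H (red_class H u)
           \<le> tame_at B (red_class B (\<beta> u)) + enat (size (\<beta> u)) + 1))
     \<and>
     (\<forall>u \<in> atoms H.
        ereal_of_enat (tame_at H (red_class H u))
          \<le> max (ereal_of_enat (tame_at B (red_class B (\<beta> u))))
                ((3 + (ereal (real (size (\<phi> u))) - 1) * (ereal_of_enat D - 1)) / 2) \<and>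
        max (ereal_of_enat (tame_at B (red_class B (\<beta> u))))
            ((3 + (ereal (real (size (\<phi> u))) - 1) * (ereal_of_enat D - 1)) / 2)
          \<le> 1 + ereal (real (size (\<phi> u))) * (ereal_of_enat D - 1) / 2)
     \<and>
     (tame_degree B \<le> tame_degree H \<and>
      ereal_of_enat (tame_degree H)
        \<le> max (ereal_of_enat (tame_degree B)) ((3 + (ereal_of_enat D - 1)\<^sup>2) / 2) \<and>
      max (ereal_of_enat (tame_degree B)) ((3 + (ereal_of_enat D - 1)\<^sup>2) / 2)
        \<le> 1 + ereal_of_enat D * (ereal_of_enat D - 1) / 2 \<and>
      (tame_degree H > D \<longrightarrow>
        (let M = {1 + Inf (lengths B W) | W.
                    W \<in> carrier (zero_sum_monoid G (GP - {\<one>\<^bsub>G\<^esub>})) \<and>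
                    ereal (real (size W)) \<le> ereal_of_enat D * (ereal_of_enat D - 1)}
         in finite M \<and> tame_degree H \<le> enat (Max M))))
     \<and>
     (GP = (\<lambda>g. inv\<^bsub>G\<^esub> g) ` GP \<longrightarrow>
        (\<forall>U \<in> atoms B. size U \<ge> 3 \<longrightarrow> tame_at B (red_class B U) \<ge> enat (size U)) \<and>
        (D \<ge> 3 \<longrightarrow> tame_degree B \<ge> D))"
proof -
  let ?S = "\<phi> ` carrier H"
  interpret H: multiset_realization H \<phi>
    by (rule realization_of_divisor_hom(1)[OF H \<phi>(1)])
  interpret C: saturated_submonoid P ?S
    by unfold_locales (rule H.sat, rule realization_of_divisor_hom(2)[OF H \<phi>(1)])
  have B': "B = C.B" unfolding B G GP ..
  have D': "D = davenport C.Cl C.GP" unfolding D G GP ..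
  let ?T = "carrier B"
  have \<beta>_eq: "\<beta> u = image_mset C.c (\<phi> u)" for u
    unfolding \<beta> block_hom_def ..
  have atoms_B: "atoms B = min_elems ?T" unfolding B' by (rule C.atoms_B)
  have \<phi>_atom: "\<phi> u \<in> min_elems ?S" if "u \<in> atoms H" for u
    using that H.image_atoms by blast
  have \<beta>_atom: "\<beta> u \<in> atoms B" if "u \<in> atoms H" for u
    using C.image_atom_iff[of "\<phi> u"] \<phi>_atom[OF that] C.image_S unfolding atoms_B unfolding B' \<beta>_eq by (auto simp: min_elems_def)
  have \<beta>_surj: "\<exists>u\<in>atoms H. U = \<beta> u" if U: "U \<in> atoms B" for U
  proof -
    have "U \<in> carrier C.B" using U unfolding B' atoms_def by auto
    then obtain a where a: "a \<in> ?S" "image_mset C.c a = U" using C.lift_block by blast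
    then have "a \<in> min_elems ?S" using C.image_atom_iff[OF a(1)] U unfolding atoms_B unfolding B' by simp
    then have "a \<in> \<phi> ` atoms H" unfolding H.image_atoms .
    then show ?thesis using a(2) unfolding \<beta>_eq by blast
  qed
  have tH: "tame_at H (red_class H u) \<le> enat n \<longleftrightarrow> tame_bound ?S (\<phi> u) n" if "u \<in> atoms H" for u n
    by (rule H.tame_at_le_iff[OF that])
  have tB: "tame_at B (red_class B U) \<le> enat n \<longleftrightarrow> tame_bound ?T U n" if "U \<in> atoms B" for U n
    using C.B.tame_at_le_iff[of U n] that unfolding B' by simp
  have d_bound: "size U \<le> d" if "D = enat d" "U \<in> min_elems ?T" for d U
    using C.davenport_le_iff[of d] that unfolding D' B' by simp
  have redH: "atoms (red H) = red_class H ` atoms H" by (rule H.atoms_red)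
  have redB: "atoms (red B) = red_class B ` atoms B" unfolding B' by (rule C.B.atoms_red)

  have lower: "tame_at B (red_class B (\<beta> u)) \<le> tame_at H (red_class H u)" if u: "u \<in> atoms H" for u
  proof (rule enat_leI)
    fix n assume "tame_at H (red_class H u) \<le> enat n"
    then have "tame_bound ?T (\<beta> u) n"
      using C.tame_bound_project[OF \<phi>_atom[OF u]] tH[OF u] unfolding \<beta>_eq B' by simp
    then show "tame_at B (red_class B (\<beta> u)) \<le> enat n" using tB[OF \<beta>_atom[OF u]] by simp
  qed
  have upper: "tame_at H (red_class H u) \<le> tame_at B (red_class B (\<beta> u)) + enat (size (\<beta> u)) + 1"
    if u: "u \<in> atoms H" for u
  proof (cases "tame_at B (red_class B (\<beta> u))")
    case (enat n)
    then have "tame_bound ?T (\<beta> u) n" using tB[OF \<beta>_atom[OF u], of n] by simp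
    then have "tame_bound ?S (\<phi> u) (n + size (\<phi> u) + 1)"
      using C.tame_bound_lift[OF \<phi>_atom[OF u]] unfolding \<beta>_eq B' by simp
    then have "tame_at H (red_class H u) \<le> enat (n + size (\<phi> u) + 1)" using tH[OF u] by simp
    then show ?thesis using enat unfolding \<beta>_eq by (simp add: one_enat_def)
  qed simp
  have part1: "locally_tame H \<longleftrightarrow> locally_tame B"
  proof
    assume "locally_tame H"
    then have fin: "tame_at H (red_class H u) < \<infinity>" if "u \<in> atoms H" for u
      using that unfolding locally_tame_def redH by blast
    have "tame_at B (red_class B U) < \<infinity>" if U: "U \<in> atoms B" for U
    proof -
      obtain u where u: "u \<in> atoms H" "U = \<beta> u" using \<beta>_surj[OF U] by blast
      show ?thesis unfolding u(2) by (rule le_less_trans[OF lower[OF u(1)] fin[OF u(1)]])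
    qed
    then show "locally_tame B" unfolding locally_tame_def redB by blast
  next
    assume "locally_tame B"
    then have fin: "tame_at B (red_class B U) < \<infinity>" if "U \<in> atoms B" for U
      using that unfolding locally_tame_def redB by blast
    have "tame_at H (red_class H u) < \<infinity>" if u: "u \<in> atoms H" for u
    proof -
      obtain n where "tame_at B (red_class B (\<beta> u)) = enat n" using fin[OF \<beta>_atom[OF u]] by auto
      then have "tame_at H (red_class H u) \<le> enat (n + size (\<beta> u) + 1)"
        using upper[OF u] by (simp add: one_enat_def)
      then show ?thesis by (rule le_less_trans) simp
    qed
    then show "locally_tame H" unfolding locally_tame_def redH by blast
  qed

  have upper_max: "tame_at H (red_class H u)
      \<le> max (tame_at B (red_class B (\<beta> u))) (enat ((3 + (size (\<phi> u) - 1) * (d - 1)) div 2))"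
    if u: "u \<in> atoms H" and d: "D = enat d" for u d
  proof (cases "tame_at B (red_class B (\<beta> u))")
    case (enat n)
    have "2 \<le> d" using D_ge_2 d by (simp add: numeral_eq_enat)
    have "tame_bound ?T (\<beta> u) n" using tB[OF \<beta>_atom[OF u], of n] enat by simp
    then have "tame_bound ?S (\<phi> u) (max n ((3 + (size (\<phi> u) - 1) * (d - 1)) div 2))"
      using C.tame_bound_lift_max[OF \<phi>_atom[OF u] _ _ \<open>2 \<le> d\<close>] d_bound[OF d] unfolding \<beta>_eq B' by blast
    then show ?thesis using tH[OF u] enat by simp
  qed simp
  have half: "tame_at B (red_class B U) \<le> enat ((2 + size U * (d - 1)) div 2)"
    if U: "U \<in> atoms B" and d: "D = enat d" for U d
  proof -
    have "2 \<le> d" using D_ge_2 d by (simp add: numeral_eq_enat)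
    then have "tame_bound ?T U ((2 + size U * (d - 1)) div 2)"
      using tame_bound_half[OF C.sat_B] U d_bound[OF d] unfolding atoms_B unfolding B' by blast
    then show ?thesis using tB[OF U] by simp
  qed
  have size_\<phi>: "1 \<le> size (\<phi> u)" if "u \<in> atoms H" for u
    using \<phi>_atom[OF that] unfolding min_elems_def by (auto simp: Suc_le_eq nonempty_has_size)
  have part2: "ereal_of_enat (tame_at H (red_class H u))
          \<le> max (ereal_of_enat (tame_at B (red_class B (\<beta> u))))
                ((3 + (ereal (real (size (\<phi> u))) - 1) * (ereal_of_enat D - 1)) / 2) \<and>
        max (ereal_of_enat (tame_at B (red_class B (\<beta> u))))
            ((3 + (ereal (real (size (\<phi> u))) - 1) * (ereal_of_enat D - 1)) / 2)
          \<le> 1 + ereal (real (size (\<phi> u))) * (ereal_of_enat D - 1) / 2"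
    if u: "u \<in> atoms H" for u
  proof (rule ereal_local_bounds[OF D_ge_2 size_\<phi>[OF u]])
    assume "size (\<phi> u) = 1"
    then have "tame_bound ?S (\<phi> u) 0" by (rule tame_bound_singleton[OF H.sat \<phi>_atom[OF u]])
    then have "tame_at H (red_class H u) \<le> 0" using tH[OF u, of 0] by (simp add: zero_enat_def)
    then show "tame_at H (red_class H u) = 0 \<and> tame_at B (red_class B (\<beta> u)) = 0"
      using lower[OF u] by simp
  next
    fix d assume "D = enat d"
    then show "tame_at H (red_class H u) \<le> max (tame_at B (red_class B (\<beta> u)))
          (enat ((3 + (size (\<phi> u) - 1) * (d - 1)) div 2)) \<and>
        tame_at B (red_class B (\<beta> u)) \<le> enat ((2 + size (\<phi> u) * (d - 1)) div 2)"
      using upper_max[OF u] half[OF \<beta>_atom[OF u]] by (simp add: \<beta>_eq)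
  qed

  have degH: "tame_at H (red_class H u) \<le> tame_degree H" if "u \<in> atoms H" for u
    using that unfolding tame_degree_def redH by (intro SUP_upper) simp
  have degB: "tame_at B (red_class B U) \<le> tame_degree B" if "U \<in> atoms B" for U
    using that unfolding tame_degree_def redB by (intro SUP_upper) simp
  have degH_le: "tame_degree H \<le> x" if "\<And>u. u \<in> atoms H \<Longrightarrow> tame_at H (red_class H u) \<le> x" for x
    using that unfolding tame_degree_def redH by (intro SUP_least) auto
  have degB_le: "tame_degree B \<le> x" if "\<And>U. U \<in> atoms B \<Longrightarrow> tame_at B (red_class B U) \<le> x" for x
    using that unfolding tame_degree_def redB by (intro SUP_least) auto
  have deg_lower: "tame_degree B \<le> tame_degree H"
  proof (rule degB_le)
    fix U assume "U \<in> atoms B"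
    then obtain u where u: "u \<in> atoms H" "U = \<beta> u" using \<beta>_surj by blast
    show "tame_at B (red_class B U) \<le> tame_degree H"
      unfolding u(2) by (rule order_trans[OF lower[OF u(1)] degH[OF u(1)]])
  qed
  have part3: "ereal_of_enat (tame_degree H)
        \<le> max (ereal_of_enat (tame_degree B)) ((3 + (ereal_of_enat D - 1)\<^sup>2) / 2) \<and>
      max (ereal_of_enat (tame_degree B)) ((3 + (ereal_of_enat D - 1)\<^sup>2) / 2)
        \<le> 1 + ereal_of_enat D * (ereal_of_enat D - 1) / 2"
  proof (rule ereal_global_bounds[OF D_ge_2], intro conjI)
    fix d assume d: "D = enat d"
    show "tame_degree H \<le> max (tame_degree B) (enat ((3 + (d - 1) * (d - 1)) div 2))"
    proof (rule degH_le)
      fix u assume u: "u \<in> atoms H"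
      have "size (\<beta> u) \<le> d" using d_bound[OF d] \<beta>_atom[OF u] unfolding atoms_B by blast
      then have "(size (\<phi> u) - 1) * (d - 1) \<le> (d - 1) * (d - 1)"
        unfolding \<beta>_eq by (intro mult_le_mono1 diff_le_mono) simp
      then have "enat ((3 + (size (\<phi> u) - 1) * (d - 1)) div 2) \<le> enat ((3 + (d - 1) * (d - 1)) div 2)"
        unfolding enat_ord_simps by (intro div_le_mono add_left_mono)
      then show "tame_at H (red_class H u) \<le> max (tame_degree B) (enat ((3 + (d - 1) * (d - 1)) div 2))"
        by (rule order_trans[OF upper_max[OF u d] max.mono[OF degB[OF \<beta>_atom[OF u]]]])
    qed
    show "tame_degree B \<le> enat ((2 + d * (d - 1)) div 2)"
    proof (rule degB_le)
      fix U assume U: "U \<in> atoms B"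
      have "size U * (d - 1) \<le> d * (d - 1)" using d_bound[OF d] U unfolding atoms_B by simp
      then have "enat ((2 + size U * (d - 1)) div 2) \<le> enat ((2 + d * (d - 1)) div 2)"
        unfolding enat_ord_simps by (intro div_le_mono add_left_mono)
      then show "tame_at B (red_class B U) \<le> enat ((2 + d * (d - 1)) div 2)"
        by (rule order_trans[OF half[OF U d]])
    qed
  qed
  let ?M = "{1 + Inf (lengths B W) | W.
      W \<in> carrier (zero_sum_monoid G (GP - {\<one>\<^bsub>G\<^esub>})) \<and>
      ereal (real (size W)) \<le> ereal_of_enat D * (ereal_of_enat D - 1)}"
  have part3': "finite ?M \<and> tame_degree H \<le> enat (Max ?M)" if less: "tame_degree H > D"
  proof -
    obtain d where d: "D = enat d" using less by (cases D) auto
    have "1 \<le> d" using D_ge_2 d by (simp add: numeral_eq_enat)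
    then have cond: "ereal (real n) \<le> ereal_of_enat D * (ereal_of_enat D - 1) \<longleftrightarrow> n \<le> d * (d - 1)" for n
    proof -
      have "ereal_of_enat D * (ereal_of_enat D - 1) = ereal (real (d * (d - 1)))"
        using d \<open>1 \<le> d\<close> by (simp add: one_ereal_def of_nat_diff)
      then show ?thesis by (simp only: ereal_less_eq of_nat_le_iff)
    qed
    have M: "?M = {1 + Inf (lengths B W) | W. (W \<in> ?T \<and> (\<forall>g\<in>#W. {#g#} \<notin> ?T)) \<and> size W \<le> d * (d - 1)}"
      unfolding cond unfolding B' G GP by (simp only: C.carrier_zero_free)
    have min: "\<exists>Z. set_mset Z \<subseteq> min_elems ?T \<and> \<Sum>\<^sub># Z = W \<and> size Z = Inf (lengths B W) \<and> size Z \<le> size W"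
      if W: "W \<in> ?T" "\<forall>g\<in>#W. {#g#} \<notin> ?T" for W
    proof -
      have L: "lengths B W = {size Z | Z. set_mset Z \<subseteq> min_elems ?T \<and> \<Sum>\<^sub># Z = W}"
        using C.B.lengths_eq[of W] W(1) unfolding B' by simp
      obtain Y where Y: "set_mset Y \<subseteq> min_elems ?T" "\<Sum>\<^sub># Y = W" "size Y * 2 \<le> size W"
        using short_factorization[OF C.sat_B, of W] W unfolding B' by blast
      then have Y': "size Y \<in> lengths B W" unfolding L by blast
      then have "Inf (lengths B W) \<in> lengths B W" by (intro Inf_nat_def1) blast
      then have "Inf (lengths B W) \<in> {size Z | Z. set_mset Z \<subseteq> min_elems ?T \<and> \<Sum>\<^sub># Z = W}"
        by (simp only: L)
      then obtain Z where Z: "set_mset Z \<subseteq> min_elems ?T" "\<Sum>\<^sub># Z = W" "size Z = Inf (lengths B W)"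
        by auto
      have "size Z \<le> size W"
        using cInf_lower[OF Y'] Y(3) unfolding Z(3) by simp
      then show ?thesis using Z by blast
    qed
    have "?M \<subseteq> {..1 + d * (d - 1)}"
    proof
      fix n assume "n \<in> ?M"
      then obtain W where W: "n = 1 + Inf (lengths B W)" "W \<in> ?T" "\<forall>g\<in>#W. {#g#} \<notin> ?T" "size W \<le> d * (d - 1)"
        unfolding M by blast
      then have "Inf (lengths B W) \<le> size W" using min[OF W(2,3)] by auto
      then show "n \<in> {..1 + d * (d - 1)}" using W(1,4) by simp
    qed
    then have fin: "finite ?M" by (rule finite_subset) simp
    \<comment> \<open>The replaced factors number at most \<open>d\<close>; since \<open>t(H) > d\<close>, only the new factors count.\<close>
    have "tame_degree H \<le> enat (max d (Max ?M))"
    proof (rule degH_le)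
      fix u assume u: "u \<in> atoms H"
      have "tame_bound ?S (\<phi> u) (max d (Max ?M))"
      proof (rule C.tame_bound_min_lengths[OF \<phi>_atom[OF u]])
        show "size V \<le> d" if "V \<in> min_elems (carrier C.B)" for V
          using d_bound[OF d] that unfolding B' by blast
        fix W assume W: "W \<in> carrier C.B" "\<forall>g\<in>#W. {#g#} \<notin> carrier C.B" "size W \<le> d * (d - 1)"
        then obtain Z where Z: "set_mset Z \<subseteq> min_elems ?T" "\<Sum>\<^sub># Z = W" "size Z = Inf (lengths B W)"
          using min[of W] unfolding B' by blast
        have "1 + size Z \<in> ?M" unfolding M Z(3) using W unfolding B' by blast
        then have "1 + size Z \<le> Max ?M" using fin by simp
        then show "\<exists>Z. set_mset Z \<subseteq> min_elems (carrier C.B) \<and> \<Sum>\<^sub># Z = W \<and> 1 + size Z \<le> Max ?M"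
          using Z(1,2) unfolding B' by blast
      qed
      then show "tame_at H (red_class H u) \<le> enat (max d (Max ?M))" using tH[OF u] by simp
    qed
    moreover have "enat d < tame_degree H" using less d by simp
    ultimately have "tame_degree H \<le> enat (Max ?M)"
      by (cases "tame_degree H") (auto simp: max_def split: if_splits)
    then show ?thesis using fin by simp
  qed

  have part4: "enat (size U) \<le> tame_at B (red_class B U)"
    if sym: "GP = (\<lambda>g. inv\<^bsub>G\<^esub> g) ` GP" and U: "U \<in> atoms B" "3 \<le> size U" for U
  proof (rule enat_leI)
    fix n assume "tame_at B (red_class B U) \<le> enat n"
    then have "tame_bound (carrier C.B) U n" using tB[OF U(1)] unfolding B' by simp
    then show "enat (size U) \<le> enat n"
      using C.tame_bound_ge_size[OF _ _ U(2)] sym U(1) unfolding atoms_B unfolding B' G GP by simp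
  qed
  have part4': "D \<le> tame_degree B" if sym: "GP = (\<lambda>g. inv\<^bsub>G\<^esub> g) ` GP" and D3: "3 \<le> D"
  proof -
    have "\<not> D \<le> enat 2" using D3 by (auto simp: numeral_eq_enat dest: order_trans)
    then obtain V where V: "V \<in> atoms B" "3 \<le> size V"
      using C.davenport_le_iff[of 2] unfolding D' atoms_B unfolding B' by force
    have big: "enat (size U) \<le> tame_degree B" if "U \<in> atoms B" "3 \<le> size U" for U
      using part4[OF sym that] degB[OF that(1)] by (rule order_trans)
    have "enat (size U) \<le> tame_degree B" if U: "U \<in> atoms B" for U
    proof (cases "3 \<le> size U")
      case False
      then have "enat (size U) \<le> enat (size V)" using V(2) by simp
      then show ?thesis using big[OF V] by (rule order_trans)
    qed (rule big[OF U])
    then show ?thesis unfolding D davenport_def B by (intro SUP_least) (simp add: B)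
  qed
  show ?thesis
    unfolding Let_def
    by (intro conjI ballI impI part1 lower upper part2[THEN conjunct1] part2[THEN conjunct2] deg_lower
        part3[THEN conjunct1] part3[THEN conjunct2] part3'[THEN conjunct1] part3'[THEN conjunct2]
        part4 part4')
qed

end
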